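(* Let $F$ be a free group and $A<F$ a finitely generated subgroup. Then there exists a set $N\subset\mathbb{N}$ of cardinality bounded above by $13\cdot\mathrm{rk}(A)$ such that $$\mathcal{O}_A(F)=\bigcup_{n\in N}\ \bigcup_{d\mid n}\{d\}.$$
   Context: $\mathrm{rk}(A)$ denotes the rank of the free group $A$. For a subset $S$ of a group $G$ and $g\in G$, the relative order $\mathcal{O}_S(g)$ of $g$ with respect to $S$ is the smallest integer $n\ge1$ such that $g^n\in S$. The $S$-spectrum of $G$ is the set $\mathcal{O}_S(G)$ of all relative orders $\mathcal{O}_S(g)$, $g\in G$ (elements $g$ with no positive power in $S$ contribute nothing). In the union, $d$ ranges over the positive divisors of $n$.
   Formalization: The subgroup A is assumed non-trivial: for A = {1} the rank is 0, so N would be empty and the union empty, while the A-spectrum of F contains 1. *)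

theory Defs
  imports "HOL-Algebra.Generated_Groups"
begin

(* A word over X is a list of letters (x, e) with x in X;
   the letter (x, True) stands for x and (x, False) for its inverse. *)

definition letter_value :: "('a, 'b) monoid_scheme \<Rightarrow> 'a \<times> bool \<Rightarrow> 'a" where
  "letter_value G l = (if snd l then fst l else inv\<^bsub>G\<^esub> (fst l))"

definition word_value :: "('a, 'b) monoid_scheme \<Rightarrow> ('a \<times> bool) list \<Rightarrow> 'a" where
  "word_value G w = foldr (\<lambda>l g. letter_value G l \<otimes>\<^bsub>G\<^esub> g) w \<one>\<^bsub>G\<^esub>"

definition reduced_words :: "'a set \<Rightarrow> ('a \<times> bool) list set" where
  "reduced_words X =
     {w. fst ` set w \<subseteq> X \<and> successively (\<lambda>l m. \<not> (fst l = fst m \<and> snd l \<noteq> snd m)) w}"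

definition free_basis :: "('a, 'b) monoid_scheme \<Rightarrow> 'a set \<Rightarrow> bool" where
  "free_basis G X \<longleftrightarrow>
     X \<subseteq> carrier G \<and> bij_betw (word_value G) (reduced_words X) (carrier G)"

definition free_group :: "('a, 'b) monoid_scheme \<Rightarrow> bool" where
  "free_group G \<longleftrightarrow> group G \<and> (\<exists>X. free_basis G X)"

(* All bases of a free group have the same cardinality, so the choice is immaterial.
   Meaningful only for free groups of finite rank, as card is 0 on infinite sets. *)
definition free_rank :: "('a, 'b) monoid_scheme \<Rightarrow> nat" where
  "free_rank G = card (SOME X. free_basis G X)"

definition finitely_generated_subgroup :: "'a set \<Rightarrow> ('a, 'b) monoid_scheme \<Rightarrow> bool" where
  "finitely_generated_subgroup A G \<longleftrightarrow>
     subgroup A G \<and> (\<exists>S. finite S \<and> S \<subseteq> carrier G \<and> A = generate G S)"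

(* Unspecified when no positive power of g lies in S; the spectrum below excludes such g. *)
definition relative_order :: "('a, 'b) monoid_scheme \<Rightarrow> 'a set \<Rightarrow> 'a \<Rightarrow> nat" where
  "relative_order G S g = (LEAST n::nat. 1 \<le> n \<and> g [^]\<^bsub>G\<^esub> n \<in> S)"

definition spectrum :: "('a, 'b) monoid_scheme \<Rightarrow> 'a set \<Rightarrow> nat set" where
  "spectrum G S =
     relative_order G S ` {g \<in> carrier G. \<exists>n::nat. 1 \<le> n \<and> g [^]\<^bsub>G\<^esub> n \<in> S}"

end

theory Submission
  imports Defs
begin

text \<open>
  Represent \<open>A\<close> by its Schreier graph of right cosets, and let \<open>r\<close> be the rank of \<open>A\<close>. If \<open>g\<close> has
  relative order \<open>n \<ge> 2\<close>, then \<open>n\<close> divides the period \<open>m\<close> of a loop \<open>w\<^sup>m\<close> at some coset, where \<open>w\<close>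
  is cyclically reduced and not a proper power. It suffices to show that at most \<open>r\<close> such periods
  exceed \<open>10 r\<close>, since all smaller elements of the spectrum can be put into \<open>N\<close>.

  Homomorphisms from \<open>A\<close> to \<open>\<int>/2\<close> come from edge sets of the graph, and there are only \<open>2\<^sup>r\<close> of them.
  Hence a finite subgraph has at most \<open>r\<close> more edges than vertices, and at most \<open>r\<close> loops can be
  independent modulo 2. As in the stacking argument of Louder and Wilton for the W-cycles
  conjecture, order the positions on a loop \<open>w\<^sup>m\<close> by a bi-invariant order of the free group (from
  the Magnus expansion), applied to the rotations of \<open>w\<close>. By the Euler characteristic bound, the
  positions that are topmost over their vertex leave out pieces of at most \<open>r\<close> of the \<open>m\<close> periods,
  and likewise for the lowest ones. So if \<open>m > 10 r\<close>, some stretch of two periods runs through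
  vertices that are visited once and are not branch points of the union of the loops considered.
  A loop with a word no longer than \<open>w\<close> that enters this stretch has to follow it, and then its
  word commutes with \<open>w\<close> and it is the same loop. Thus every long loop has an edge, traversed once,
  which is missed by all the others with words no longer than its own, and the long loops are
  independent modulo 2.
\<close>

section \<open>Words and free reduction\<close>

definition flip :: "'x \<times> bool \<Rightarrow> 'x \<times> bool" where
  "flip l = (fst l, \<not> snd l)"

lemma flip_flip [simp]: "flip (flip l) = l"
  and fst_flip [simp]: "fst (flip l) = fst l"
  and snd_flip [simp]: "snd (flip l) = (\<not> snd l)"
  and flip_neq [simp]: "flip l \<noteq> l" "l \<noteq> flip l"
  and flip_eq_iff [simp]: "flip l = flip m \<longleftrightarrow> l = m"
  by (auto simp: flip_def prod_eq_iff)

lemma fst_eq_flip_cases: "fst l = fst m \<Longrightarrow> l = m \<or> l = flip m"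
  by (auto simp: flip_def prod_eq_iff)

definition inv_word :: "('x \<times> bool) list \<Rightarrow> ('x \<times> bool) list" where
  "inv_word w = rev (map flip w)"

lemma inv_word_simps [simp]:
  "inv_word [] = []" "inv_word (l # w) = inv_word w @ [flip l]"
  "inv_word (u @ w) = inv_word w @ inv_word u"
  "length (inv_word w) = length w" "fst ` set (inv_word w) = fst ` set w"
  "inv_word (inv_word w) = w" "inv_word w = [] \<longleftrightarrow> w = []"
  by (auto simp: inv_word_def rev_map image_image comp_def)

abbreviation reduced :: "('x \<times> bool) list \<Rightarrow> bool" where
  "reduced \<equiv> successively (\<lambda>l m. m \<noteq> flip l)"

lemma reduced_words_iff: "w \<in> reduced_words X \<longleftrightarrow> fst ` set w \<subseteq> X \<and> reduced w"
proof -
  have "successively (\<lambda>l m. \<not> (fst l = fst m \<and> snd l \<noteq> snd m)) w \<longleftrightarrow> reduced w"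
    by (intro successively_cong refl) (auto simp: flip_def prod_eq_iff)
  then show ?thesis unfolding reduced_words_def by blast
qed

lemma reduced_inv_word [simp]: "reduced (inv_word w) \<longleftrightarrow> reduced w"
proof -
  have "successively (\<lambda>l m. flip l \<noteq> flip (flip m)) w \<longleftrightarrow> reduced w"
    by (intro successively_cong refl) auto
  then show ?thesis
    unfolding inv_word_def successively_rev successively_map .
qed

definition cancel_cons :: "'x \<times> bool \<Rightarrow> ('x \<times> bool) list \<Rightarrow> ('x \<times> bool) list" where
  "cancel_cons l w = (if w \<noteq> [] \<and> hd w = flip l then tl w else l # w)"

definition red :: "('x \<times> bool) list \<Rightarrow> ('x \<times> bool) list" where
  "red w = foldr cancel_cons w []"

lemma red_simps [simp]: "red [] = []" "red (l # w) = cancel_cons l (red w)"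
  by (simp_all add: red_def)

lemma red_cong_suffix: "red w = red w' \<Longrightarrow> red (u @ w) = red (u @ w')"
  by (induction u) auto

lemma cancel_cons_cases:
  obtains v where "w = flip l # v" "cancel_cons l w = v"
  | "cancel_cons l w = l # w" "w = [] \<or> hd w \<noteq> flip l"
  by (cases w) (auto simp: cancel_cons_def)

lemma reduced_red [simp]: "reduced (red w)"
proof (induction w)
  case (Cons l w)
  show ?case
    by (cases l "red w" rule: cancel_cons_cases)
      (use Cons in \<open>auto simp: successively_Cons\<close>)
qed auto

lemma red_eq_self: "reduced w \<Longrightarrow> red w = w"
  by (induction w) (auto simp: successively_Cons cancel_cons_def)

lemma set_red: "fst ` set (red w) \<subseteq> fst ` set w"
proof (induction w)
  case (Cons l w)
  show ?case
    by (cases l "red w" rule: cancel_cons_cases) (use Cons in auto)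
qed auto

text \<open>If \<open>flip l\<close> cancels the first letter of \<open>red w\<close>, then
  \<open>l\<close> is put back in front of the rest and does not cancel there, since
  \<open>red w\<close> is reduced.\<close>

lemma red_cancel: "red (u @ l # flip l # w) = red (u @ w)"
proof -
  have "red (l # flip l # w) = red w"
  proof (cases "red w")
    case (Cons m v)
    then have "reduced (m # v)" using reduced_red[of w] by simp
    then show ?thesis using Cons by (auto simp: cancel_cons_def successively_Cons)
  qed (auto simp: cancel_cons_def)
  then show ?thesis by (rule red_cong_suffix)
qed

text \<open>Free reduction deletes adjacent inverse pairs one at a time; the induction works behind
  an arbitrary prefix \<open>u\<close>. It is applied to edge parities and to Schreier
  rewriting.\<close>

lemma red_invariant:
  assumes "\<And>u l w. \<Phi> (u @ l # flip l # w) = \<Phi> (u @ w)"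
  shows "\<Phi> (red w) = \<Phi> w"
proof -
  have "\<Phi> (u @ red w) = \<Phi> (u @ w)" for u
  proof (induction w arbitrary: u)
    case (Cons l w)
    have "\<Phi> (u @ red (l # w)) = \<Phi> (u @ l # red w)"
      by (cases l "red w" rule: cancel_cons_cases) (auto simp: assms)
    then show ?case using Cons[of "u @ [l]"] by simp
  qed simp
  from this[of "[]"] show ?thesis by simp
qed

section \<open>Rotations of words and primitivity\<close>

definition rot_primitive :: "'x list \<Rightarrow> bool" where
  "rot_primitive w \<longleftrightarrow> w \<noteq> [] \<and> (\<forall>i. rotate i w = w \<longrightarrow> length w dvd i)"

lemma rotate_inject: "rotate i u = rotate i w \<longleftrightarrow> u = w"
proof (induction i)
  case (Suc i)
  have "rotate1 a = rotate1 b \<longleftrightarrow> a = b" for a b :: "'a list"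
    by (cases a; cases b) auto
  then show ?case using Suc by simp
qed simp

lemma rot_primitive_rotate:
  assumes "rot_primitive w"
  shows "rot_primitive (rotate i w)"
proof -
  have "length w dvd j" if "rotate j (rotate i w) = rotate i w" for j
  proof -
    have "rotate i (rotate j w) = rotate i w"
      using that unfolding rotate_rotate by (metis add.commute)
    then have "rotate j w = w" unfolding rotate_inject .
    then show ?thesis using assms unfolding rot_primitive_def by blast
  qed
  then show ?thesis using assms unfolding rot_primitive_def length_rotate rotate_is_Nil_conv by blast
qed

lemma rotate_primitive_eq:
  assumes "rot_primitive w" "rotate i w = rotate j w"
  shows "i mod length w = j mod length w"
proof -
  have *: "j mod length w = i mod length w" if le: "i \<le> j" and eq: "rotate i w = rotate j w" for i j
  proof -
    have "rotate i (rotate (j - i) w) = rotate j w"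
      using le by (simp only: rotate_rotate le_add_diff_inverse)
    then have "rotate (j - i) w = w"
      unfolding eq[symmetric] rotate_inject .
    then have "length w dvd j - i"
      using assms(1) unfolding rot_primitive_def by blast
    then show ?thesis by (simp only: mod_eq_dvd_iff_nat[OF le])
  qed
  show ?thesis
  proof (cases "i \<le> j")
    case True
    show ?thesis by (rule *[OF True assms(2), symmetric])
  next
    case False
    then have "j \<le> i" by linarith
    then show ?thesis by (rule *[OF _ assms(2)[symmetric]])
  qed
qed

text \<open>Rotating a power of \<open>z\<close> by \<open>length z\<close> fixes it, so primitivity
  makes the whole word no longer than \<open>z\<close>.\<close>

lemma rot_primitive_replicate:
  assumes "rot_primitive (concat (replicate k z))"
  shows "concat (replicate k z) = z"
proof -
  let ?w = "concat (replicate k z)"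
  have k: "k \<noteq> 0" using assms by (auto simp: rot_primitive_def)
  then obtain j where j: "k = Suc j" by (cases k) auto
  have "concat (replicate j z) @ z = z @ concat (replicate j z)"
    by (induction j) auto
  then have "rotate (length z) ?w = ?w"
    using rotate_append[of z "concat (replicate j z)"] j by simp
  then have "length ?w dvd length z" using assms by (auto simp: rot_primitive_def)
  moreover have "z \<noteq> []" using assms by (auto simp: rot_primitive_def)
  ultimately have "length ?w \<le> length z" by (auto dest: dvd_imp_le)
  then have "concat (replicate j z) = []" using j by auto
  then show ?thesis using j by simp
qed

text \<open>Commuting words are powers of a common word. This is what finally identifies two loops
  whose letters agree for long enough.\<close>

lemma rot_primitive_commute:
  assumes "rot_primitive u" "rot_primitive v" "u @ v = v @ u"
  shows "u = v"
proof -
  obtain m n z where "concat (replicate m z) = u" "concat (replicate n z) = v"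
    using comm_append_are_replicate[OF assms(3)] by blast
  then have "u = z" "v = z"
    using rot_primitive_replicate[of m z] rot_primitive_replicate[of n z] assms(1,2) by auto
  then show ?thesis by simp
qed

text \<open>A proper rotation that fixes \<open>w\<close> splits it into two commuting pieces, which
  are powers of a shorter word; induction on the length finishes.\<close>

lemma rot_primitive_root:
  "w \<noteq> [] \<Longrightarrow> \<exists>z k. rot_primitive z \<and> 1 \<le> k \<and> w = concat (replicate k z)"
proof (induction "length w" arbitrary: w rule: less_induct)
  case less
  show ?case
  proof (cases "rot_primitive w")
    case True
    then show ?thesis by (intro exI[of _ w] exI[of _ 1]) auto
  next
    case False
    then obtain i where i: "rotate i w = w" "\<not> length w dvd i"
      using less.prems by (auto simp: rot_primitive_def)
    define j where "j = i mod length w"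
    have j: "0 < j" "j < length w"
      using i less.prems by (auto simp: j_def mod_greater_zero_iff_not_dvd)
    have "drop j w @ take j w = w"
      using i(1) unfolding rotate_drop_take j_def .
    then have "drop j w @ take j w = take j w @ drop j w"
      unfolding append_take_drop_id .
    from comm_append_are_replicate[OF this[symmetric]]
    obtain m n z where z: "concat (replicate m z) = take j w" "concat (replicate n z) = drop j w"
      by blast
    have w: "w = concat (replicate (m + n) z)"
      unfolding replicate_add concat_append z append_take_drop_id ..
    have mn: "0 < m" using z(1) j by (cases m) auto
    have mn': "0 < n" using z(2) j by (cases n) auto
    have zne: "z \<noteq> []"
    proof
      assume "z = []"
      then have "concat (replicate m z) = []" by simp
      then show False using z(1) j by simp
    qed
    have "length (concat (replicate (m + n) z)) = (m + n) * length z"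
      by (simp add: length_concat sum_list_replicate)
    then have "length w = (m + n) * length z" by (simp only: w[symmetric])
    then have "length z < length w" using mn mn' zne by simp
    from less.hyps[OF this zne] obtain y k where
      y: "rot_primitive y" "1 \<le> k" "z = concat (replicate k y)" by blast
    have "concat (replicate a z) = concat (replicate (a * k) y)" for a
    proof (induction a)
      case (Suc a)
      have "concat (replicate (Suc a) z) = z @ concat (replicate a z)" by simp
      also have "\<dots> = concat (replicate k y) @ concat (replicate (a * k) y)"
        unfolding Suc y(3)[symmetric] ..
      finally show ?case by (simp add: replicate_add)
    qed simp
    from trans[OF w this] have "w = concat (replicate ((m + n) * k) y)" .
    moreover have "1 \<le> (m + n) * k" using mn y(2) by simp
    ultimately show ?thesis using y(1) by blast
  qed
qed

lemma rot_primitive_inv_word: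
  assumes "rot_primitive w"
  shows "rot_primitive (inv_word w)"
proof -
  have "length w dvd i" if i: "rotate i (inv_word w) = inv_word w" for i
  proof -
    define j where "j = i mod length w"
    have w: "w \<noteq> []" using assms by (simp add: rot_primitive_def)
    then have j: "j < length w" by (simp add: j_def)
    let ?a = "take j (inv_word w)" and ?b = "drop j (inv_word w)"
    have "?b @ ?a = inv_word w"
      using i by (simp add: rotate_drop_take j_def)
    then have "inv_word (?b @ ?a) = w" by simp
    then have 1: "inv_word ?a @ inv_word ?b = w" by simp
    have "inv_word (?a @ ?b) = w" unfolding append_take_drop_id by simp
    then have 2: "inv_word ?b @ inv_word ?a = w" by (simp only: inv_word_simps)
    have "rotate (length ?b) w = w"
      using rotate_append[of "inv_word ?b" "inv_word ?a"] 1 2 by simp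
    then have "length w dvd length w - j" using assms by (simp add: rot_primitive_def)
    then have "length w \<le> length w - j" using j by (intro dvd_imp_le) auto
    then have "j = 0" using j by linarith
    then show ?thesis by (auto simp: j_def)
  qed
  then show ?thesis using assms unfolding rot_primitive_def inv_word_simps by blast
qed

section \<open>A bi-invariant order on words\<close>

text \<open>Noncommutative power series, given by their coefficients. Monomials are stored in reverse, so that
  right multiplication by \<open>1 + x\<close> or its inverse (\<open>rmul\<close>) acts at the head of the list.\<close>

primrec rmul_inv :: "'x \<Rightarrow> ('x list \<Rightarrow> int) \<Rightarrow> 'x list \<Rightarrow> int" where
  "rmul_inv x f [] = f []"
| "rmul_inv x f (z # m) = f (z # m) - (if z = x then rmul_inv x f m else 0)"

definition rmul :: "'x \<times> bool \<Rightarrow> ('x list \<Rightarrow> int) \<Rightarrow> 'x list \<Rightarrow> int" where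
  "rmul l f = (if snd l
     then (\<lambda>m. f m + (if m \<noteq> [] \<and> hd m = fst l then f (tl m) else 0))
     else rmul_inv (fst l) f)"

text \<open>Left multiplication by \<open>1 + x\<close>. Monomials being reversed, it acts at the
  end of the list.\<close>

definition lmul :: "'x \<Rightarrow> ('x list \<Rightarrow> int) \<Rightarrow> 'x list \<Rightarrow> int" where
  "lmul x f m = f m + (if m \<noteq> [] \<and> last m = x then f (butlast m) else 0)"

text \<open>The Magnus expansion, which sends \<open>x\<close> to \<open>1 + x\<close>.\<close>

definition magnus :: "('x \<times> bool) list \<Rightarrow> 'x list \<Rightarrow> int" where
  "magnus w = foldl (\<lambda>f l. rmul l f) (\<lambda>m. if m = [] then 1 else 0) w"

lemma rmul_Nil [simp]: "rmul l f [] = f []"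
  by (auto simp: rmul_def)

lemma rmul_Cons: "rmul l f (z # m) = f (z # m) +
    (if z = fst l then if snd l then f m else - rmul l f m else 0)"
  by (auto simp: rmul_def)

lemma rmul_flip [simp]: "rmul (flip l) (rmul l f) = f"
proof
  fix m show "rmul (flip l) (rmul l f) m = f m"
    by (induction m) (auto simp: rmul_Cons)
qed

lemma rmul_diff: "rmul l (\<lambda>m. f m - g m) = (\<lambda>m. rmul l f m - rmul l g m)"
proof
  fix m show "rmul l (\<lambda>m. f m - g m) m = rmul l f m - rmul l g m"
    by (induction m) (auto simp: rmul_Cons)
qed

lemma lmul_diff: "lmul x (\<lambda>m. f m - g m) = (\<lambda>m. lmul x f m - lmul x g m)"
  by (auto simp: lmul_def fun_eq_iff)

lemma magnus_Nil: "magnus [] = (\<lambda>m. if m = [] then 1 else 0)"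
  by (simp add: magnus_def)

lemma magnus_snoc [simp]: "magnus (w @ [l]) = rmul l (magnus w)"
  by (simp add: magnus_def)

lemma magnus_append: "magnus (u @ w) = foldl (\<lambda>f l. rmul l f) (magnus u) w"
  by (simp add: magnus_def)

lemma magnus_cancel: "magnus (u @ l # flip l # w) = magnus (u @ w)"
  by (simp add: magnus_append)

lemma magnus_cancel_end [simp]: "magnus (u @ [l, flip l]) = magnus u"
  using magnus_cancel[of u l "[]"] by simp

lemma magnus_append_cong: "magnus u = magnus v \<Longrightarrow> magnus (u @ w) = magnus (v @ w)"
  by (simp add: magnus_append)

text \<open>This is associativity of the product of series. For an inverse letter it follows by
  cancelling the operator of the positive one.\<close>

lemma lmul_rmul: "lmul x (rmul l f) = rmul l (lmul x f)"
proof -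
  have pos: "lmul x (rmul (y, True) f) m = rmul (y, True) (lmul x f) m" for y f m
    by (cases m rule: rev_cases; cases m; cases "butlast m")
       (auto simp: lmul_def rmul_def butlast_append last_append split: if_splits)
  show ?thesis
  proof (cases "snd l")
    case True
    then have "l = (fst l, True)" by (simp add: prod_eq_iff)
    then show ?thesis using pos[of "fst l" f] by (metis ext)
  next
    case False
    then have l: "l = flip (fst l, True)" by (simp add: prod_eq_iff flip_def)
    define p where "p = (fst l, True)"
    have "rmul (flip p) (rmul p (lmul x (rmul (flip p) f))) = rmul (flip p) (lmul x (rmul p (rmul (flip p) f)))"
      using pos[of "fst l" "rmul (flip p) f"] unfolding p_def by (metis ext)
    moreover have "rmul p (rmul (flip p) f) = f"
      using rmul_flip[of "flip p" f] by simp
    ultimately have "lmul x (rmul (flip p) f) = rmul (flip p) (lmul x f)" by simp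
    then show ?thesis using l unfolding p_def by simp
  qed
qed

lemma magnus_Cons_pos: "magnus ((x, True) # w) = lmul x (magnus w)"
proof (induction w rule: rev_induct)
  case Nil
  have "rmul (x, True) (magnus []) m = lmul x (magnus []) m" for m
    by (cases m; cases "tl m") (auto simp: lmul_def rmul_def magnus_Nil)
  then have "rmul (x, True) (magnus []) = lmul x (magnus [])" by (rule ext)
  then show ?case using magnus_snoc[of "[]" "(x, True)"] by simp
next
  case (snoc l w)
  have "magnus ((x, True) # w @ [l]) = rmul l (magnus ((x, True) # w))"
    using magnus_snoc[of "(x, True) # w" l] by simp
  then show ?case by (simp add: snoc lmul_rmul)
qed

text \<open>On monomials without adjacent equal letters, a syllable \<open>x\<^sup>k\<close> acts as \<open>1 + k x\<close>.\<close>

lemma rmul_alternating: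
  assumes "distinct_adj (z # m)"
  shows "rmul l f (z # m) = f (z # m) + (if z = fst l then (if snd l then 1 else - 1) * f m else 0)"
  using assms by (cases m) (auto simp: rmul_Cons)

text \<open>The leading alternating monomial of the expansion: one variable for each maximal block
  of letters with the same generator.\<close>

definition syllables :: "('x \<times> bool) list \<Rightarrow> 'x list" where
  "syllables w = rev (remdups_adj (map fst w))"

lemma syllables_snoc:
  "syllables (w @ [l]) = (if w \<noteq> [] \<and> fst (last w) = fst l then syllables w else fst l # syllables w)"
  by (cases w rule: rev_cases) (auto simp: syllables_def remdups_adj_append_two)

lemma distinct_adj_syllables [simp]: "distinct_adj (syllables w)"
  by (simp add: syllables_def distinct_adj_remdups_adj)

lemma syllables_eq_Nil_iff [simp]: "syllables w = [] \<longleftrightarrow> w = []"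
  by (simp add: syllables_def)

lemma syllables_ConsE:
  assumes "w \<noteq> []"
  obtains t where "syllables w = fst (last w) # t"
proof -
  have "hd (syllables w) = fst (last w)"
    using assms by (simp add: syllables_def hd_rev last_map)
  then show ?thesis
    using assms that[of "tl (syllables w)"] by (metis list.collapse syllables_eq_Nil_iff)
qed

text \<open>On alternating monomials each syllable contributes its variable at most once, so no such
  monomial can be longer than the syllable sequence, and one of equal length must end in the last
  generator.\<close>

lemma magnus_eq_0:
  "distinct_adj m \<Longrightarrow> length (syllables w) < length m \<or>
     length (syllables w) = length m \<and> w \<noteq> [] \<and> hd m \<noteq> fst (last w) \<Longrightarrow> magnus w m = 0"
proof (induction w arbitrary: m rule: rev_induct)
  case Nil
  then show ?case by (auto simp: magnus_Nil syllables_def)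
next
  case (snoc l w)
  obtain z m' where m: "m = z # m'"
    using snoc.prems by (cases m) auto
  have m': "distinct_adj m'" "m' = [] \<or> hd m' \<noteq> z"
    using snoc.prems m by (auto simp: distinct_adj_Cons)
  have "magnus w m = 0"
    using snoc.prems(2) by (intro snoc.IH snoc.prems) (auto simp: syllables_snoc split: if_splits)
  moreover have "magnus w m' = 0" if z: "z = fst l"
  proof (cases "w \<noteq> [] \<and> fst (last w) = fst l")
    case True
    then have "length (syllables w) \<le> length m'" "m' \<noteq> []"
      using snoc.prems(2) m z by (auto simp: syllables_snoc)
    then show ?thesis using True m' z by (intro snoc.IH) (auto simp: le_less)
  next
    case False
    then show ?thesis using snoc.prems(2) m z m'
      by (intro snoc.IH) (auto simp: syllables_snoc split: if_splits)
  qed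
  ultimately show ?case using snoc.prems(1) m
    by (simp add: rmul_alternating)
qed

text \<open>The coefficient at \<open>syllables w\<close> is the product of the syllable exponents,
  hence nonzero. For the induction it is compared with the coefficient at the tail: their ratio is
  the last exponent, whose sign is that of the last letter.\<close>

lemma magnus_leading:
  "reduced w \<Longrightarrow> w \<noteq> [] \<Longrightarrow>
     0 < (if snd (last w) then 1 else - 1) * magnus w (syllables w) * magnus w (tl (syllables w))"
proof (induction w rule: rev_induct)
  case (snoc l w)
  define e :: int where "e = (if snd l then 1 else - 1)"
  have e: "e * e = 1" by (simp add: e_def)
  show ?case
  proof (cases "w = []")
    case True
    then show ?thesis by (simp add: syllables_def magnus_def rmul_def)
  next
    case False
    have red: "reduced w" "l \<noteq> flip (last w)"
      using snoc.prems False by (auto simp: successively_append_iff)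
    note IH = snoc.IH[OF red(1) False]
    define s where "s = syllables w"
    obtain t where s: "s = fst (last w) # t" using syllables_ConsE[OF False] s_def by metis
    have adj: "distinct_adj s" by (simp add: s_def)
    have t: "rmul l (magnus w) t = magnus w t" if "fst l = fst (last w)"
      using adj that s by (cases t) (auto simp: rmul_Cons)
    show ?thesis
    proof (cases "fst (last w) = fst l")
      case True
      then have "last w = l" using fst_eq_flip_cases[of l "last w"] red(2) by auto
      then have IH': "0 < e * magnus w s * magnus w t" using IH s by (simp add: e_def s_def)
      have "syllables (w @ [l]) = s" using True False by (simp add: syllables_snoc s_def)
      moreover have "rmul l (magnus w) s = magnus w s + e * magnus w t"
        using adj True by (simp add: s rmul_alternating e_def)
      \<comment> \<open>Lengthening the last syllable adds a square to the positive quantity of the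
        induction hypothesis.\<close>
      moreover have "e * (magnus w s + e * magnus w t) * magnus w t =
        e * magnus w s * magnus w t + (magnus w t)\<^sup>2"
        using e by (simp add: algebra_simps power2_eq_square)
      ultimately show ?thesis using IH' t True s by (simp add: e_def[symmetric] add_pos_nonneg)
    next
      case False': False
      have syl: "syllables (w @ [l]) = fst l # s" using False False' by (simp add: syllables_snoc s_def)
      have adj': "distinct_adj (fst l # s)" using adj s False' by auto
      have "magnus w (fst l # s) = 0"
        by (rule magnus_eq_0[OF adj']) (simp add: s_def)
      then have "rmul l (magnus w) (fst l # s) = e * magnus w s"
        using adj' by (simp add: rmul_alternating e_def)
      moreover have "rmul l (magnus w) s = magnus w s"
        using s False' by (simp add: rmul_Cons)
      moreover have "e * (e * magnus w s) * magnus w s = (magnus w s)\<^sup>2"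
        using e by (simp add: algebra_simps power2_eq_square)
      moreover have "magnus w s \<noteq> 0" using IH by (auto simp: s_def)
      ultimately show ?thesis using syl by (simp add: e_def[symmetric])
    qed
  qed
qed simp

lemma magnus_eq_Nil_imp: "reduced w \<Longrightarrow> magnus w = magnus [] \<Longrightarrow> w = []"
proof (rule ccontr)
  assume *: "reduced w" "magnus w = magnus []" "w \<noteq> []"
  then have "magnus w (syllables w) = 0" using * by (simp add: magnus_Nil)
  then show False using magnus_leading[of w] * by simp
qed

lemma magnus_append_inv_word: "magnus (u @ w @ inv_word w) = magnus u"
proof (induction w arbitrary: u)
  case (Cons l w)
  have "magnus (u @ (l # w) @ inv_word (l # w)) = magnus ((u @ [l] @ w @ inv_word w) @ [flip l])"
    by simp
  also have "\<dots> = magnus (u @ [l, flip l])"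
    using Cons[of "u @ [l]"] by (simp add: magnus_append)
  finally show ?case by simp
qed simp

text \<open>Equal last letters are cancelled. Otherwise \<open>u @ inv_word w\<close> is reduced as
  it stands and has trivial expansion, so it would have to be empty.\<close>

theorem magnus_inject:
  assumes "reduced u" "reduced w" "magnus u = magnus w"
  shows "u = w"
  using assms
proof (induction u arbitrary: w rule: rev_induct)
  case Nil
  then show ?case using magnus_eq_Nil_imp[of w] by simp
next
  case (snoc l u)
  have "magnus ((u @ [l]) @ inv_word w) = magnus (w @ inv_word w)"
    using snoc.prems(3) by (rule magnus_append_cong)
  also have "\<dots> = magnus []" using magnus_append_inv_word[of "[]" w] by simp
  finally have eq: "magnus (u @ [l] @ inv_word w) = magnus []" by simp
  show ?case
  proof (cases w rule: rev_cases)
    case Nil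
    then show ?thesis using snoc.prems magnus_eq_Nil_imp[of "u @ [l]"] by simp
  next
    case (snoc w' m)
    show ?thesis
    proof (cases "m = l")
      case True
      have "rmul (flip l) (rmul l (magnus u)) = rmul (flip l) (rmul l (magnus w'))"
        using snoc.prems(3) snoc True by simp
      then show ?thesis using snoc.IH[of w'] snoc.prems snoc True
        by (auto simp: successively_append_iff)
    next
      case False
      then have "reduced (u @ [l] @ inv_word w)"
        using snoc.prems(1,2) reduced_inv_word[of w] snoc
        by (auto simp: successively_append_iff successively_Cons)
      then show ?thesis using magnus_eq_Nil_imp[OF _ eq] by simp
    qed
  qed
qed

section \<open>Ordering power series by their lowest term\<close>

definition mono_less :: "('x list \<times> 'x list) set \<Rightarrow> 'x list \<Rightarrow> 'x list \<Rightarrow> bool" where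
  "mono_less r m m' \<longleftrightarrow> length m < length m' \<or> length m = length m' \<and> m \<noteq> m' \<and> (m, m') \<in> r"

text \<open>Positivity of the lowest nonzero coefficient. Since \<open>mono_less\<close> compares
  degrees first, multiplication by \<open>1 + x\<close> or its inverse, which alters a coefficient
  only by those of lower degree, keeps the lowest term.\<close>

definition leading_pos :: "('x list \<times> 'x list) set \<Rightarrow> ('x list \<Rightarrow> int) \<Rightarrow> bool" where
  "leading_pos r f \<longleftrightarrow> (\<exists>m. 0 < f m \<and> (\<forall>m'. mono_less r m' m \<longrightarrow> f m' = 0))"

context
  fixes r :: "('x list \<times> 'x list) set"
  assumes wo: "well_order_on UNIV r"
begin

lemma mono_less_linear: "m = m' \<or> mono_less r m m' \<or> mono_less r m' m"
  using wo by (auto simp: mono_less_def well_order_on_def linear_order_on_def total_on_def)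

lemma mono_less_minimal:
  assumes "P m"
  shows "\<exists>m. P m \<and> (\<forall>m'. mono_less r m' m \<longrightarrow> \<not> P m')"
proof -
  define k where "k = (LEAST k. \<exists>m. P m \<and> length m = k)"
  have "\<exists>m. P m \<and> length m = k"
    unfolding k_def by (rule LeastI_ex) (use assms in blast)
  then obtain m1 where m1: "m1 \<in> {m. P m \<and> length m = k}" by blast
  have wf: "wf (r - Id)" using wo by (simp add: well_order_on_def)
  from wfE_min[OF wf m1] obtain m where m: "P m" "length m = k"
    and min: "\<And>m'. (m', m) \<in> r - Id \<Longrightarrow> \<not> (P m' \<and> length m' = k)"
    by (metis (mono_tags, lifting) mem_Collect_eq)
  have "\<not> P m'" if "mono_less r m' m" for m'
  proof (cases "length m' < k")
    case True
    then show ?thesis unfolding k_def by (metis (mono_tags, lifting) not_less_Least)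
  next
    case False
    then show ?thesis using that m min[of m'] by (auto simp: mono_less_def)
  qed
  then show ?thesis using m by blast
qed

lemma leading_pos_total:
  assumes "f \<noteq> g"
  shows "leading_pos r (\<lambda>m. f m - g m) \<or> leading_pos r (\<lambda>m. g m - f m)"
proof -
  obtain m0 where "f m0 \<noteq> g m0" using assms by blast
  from mono_less_minimal[where P = "\<lambda>m. f m \<noteq> g m", OF this]
  obtain m where m: "f m \<noteq> g m" "\<And>m'. mono_less r m' m \<Longrightarrow> f m' = g m'" by blast
  then show ?thesis unfolding leading_pos_def
    by (cases "f m < g m") (metis cancel_comm_monoid_add_class.diff_cancel diff_gt_0_iff_gt linorder_neqE)+
qed

lemma leading_pos_add:
  assumes "leading_pos r f" "leading_pos r g"
  shows "leading_pos r (\<lambda>m. f m + g m)"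
proof -
  obtain a where a: "0 < f a" "\<And>m. mono_less r m a \<Longrightarrow> f m = 0"
    using assms(1) by (auto simp: leading_pos_def)
  obtain b where b: "0 < g b" "\<And>m. mono_less r m b \<Longrightarrow> g m = 0"
    using assms(2) by (auto simp: leading_pos_def)
  have trans: "mono_less r m m''" if "mono_less r m m'" "mono_less r m' m''" for m m' m''
    using that wo unfolding mono_less_def well_order_on_def linear_order_on_def partial_order_on_def
      preorder_on_def by (auto dest: transD antisymD)
  consider "a = b" | "mono_less r a b" | "mono_less r b a" using mono_less_linear by blast
  then show ?thesis
  proof cases
    case 1
    then show ?thesis unfolding leading_pos_def using a b by (intro exI[of _ a]) auto
  next
    case 2
    then show ?thesis unfolding leading_pos_def using a b trans by (intro exI[of _ a]) auto
  next
    case 3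
    then show ?thesis unfolding leading_pos_def using a b trans by (intro exI[of _ b]) auto
  qed
qed

lemma leading_pos_asym: "\<not> (leading_pos r (\<lambda>m. f m - g m) \<and> leading_pos r (\<lambda>m. g m - f m))"
proof
  assume "leading_pos r (\<lambda>m. f m - g m) \<and> leading_pos r (\<lambda>m. g m - f m)"
  then have "leading_pos r (\<lambda>m. (f m - g m) + (g m - f m))"
    by (intro leading_pos_add) auto
  then show False by (simp add: leading_pos_def)
qed

text \<open>The second hypothesis lets \<open>g\<close> differ from \<open>f\<close> only in degrees
  above that of the lowest term of \<open>f\<close>.\<close>

lemma leading_pos_perturb:
  assumes "leading_pos r f"
    and "\<And>m. (\<And>m'. length m' < length m \<Longrightarrow> f m' = 0) \<Longrightarrow> g m = f m"
  shows "leading_pos r g"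
proof -
  obtain m where m: "0 < f m" "\<And>m'. mono_less r m' m \<Longrightarrow> f m' = 0"
    using assms(1) by (auto simp: leading_pos_def)
  have g: "g m' = f m'" if "length m' \<le> length m" for m'
    using that m(2) by (intro assms(2)) (auto simp: mono_less_def)
  have "length m' \<le> length m" if "mono_less r m' m" for m'
    using that by (auto simp: mono_less_def)
  then show ?thesis unfolding leading_pos_def using m g by (intro exI[of _ m]) auto
qed

lemma leading_pos_rmul: "leading_pos r f \<Longrightarrow> leading_pos r (rmul l f)"
proof (erule leading_pos_perturb)
  fix m :: "'x list"
  assume *: "\<And>m'. length m' < length m \<Longrightarrow> f m' = 0"
  have "rmul l f m' = f m'" if "length m' \<le> length m" for m'
    using that
  proof (induction m')
    case (Cons z m')
    then show ?case using *[of m'] by (simp add: rmul_Cons)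
  qed simp
  then show "rmul l f m = f m" by simp
qed

lemma leading_pos_lmul: "leading_pos r f \<Longrightarrow> leading_pos r (lmul x f)"
  by (erule leading_pos_perturb) (simp add: lmul_def)

text \<open>The converse comes from totality: if the difference were not positive, its negative
  would be, and so would the image of the negative.\<close>

lemma leading_pos_diff_iff:
  assumes "\<And>f. leading_pos r f \<Longrightarrow> leading_pos r (T f)"
    and "\<And>f g. T (\<lambda>m. f m - g m) = (\<lambda>m. T f m - T g m)"
  shows "leading_pos r (\<lambda>m. T f m - T g m) \<longleftrightarrow> leading_pos r (\<lambda>m. f m - g m)"
proof
  assume *: "leading_pos r (\<lambda>m. T f m - T g m)"
  show "leading_pos r (\<lambda>m. f m - g m)"
  proof (rule ccontr)
    assume "\<not> ?thesis"
    moreover have "f \<noteq> g" using * by (auto simp: leading_pos_def)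
    ultimately have "leading_pos r (\<lambda>m. g m - f m)" using leading_pos_total by blast
    from assms(1)[OF this] show False using * leading_pos_asym[of "T f" "T g"]
      by (simp add: assms(2))
  qed
next
  assume "leading_pos r (\<lambda>m. f m - g m)"
  from assms(1)[OF this] show "leading_pos r (\<lambda>m. T f m - T g m)" by (simp add: assms(2))
qed

end

text \<open>All rotations of a cyclic word are conjugate, one step being conjugation by the letter that is
  moved; \<open>word_order\<close> records the two instances of conjugation invariance that this provides.\<close>

definition word_order :: "(('x \<times> bool) list \<Rightarrow> ('x \<times> bool) list \<Rightarrow> bool) \<Rightarrow> bool" where
  "word_order lt \<longleftrightarrow>
     (\<forall>u. \<not> lt u u) \<and> (\<forall>u v w. lt u v \<longrightarrow> lt v w \<longrightarrow> lt u w) \<and>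
     (\<forall>u v. reduced u \<longrightarrow> reduced v \<longrightarrow> u \<noteq> v \<longrightarrow> lt u v \<or> lt v u) \<and>
     (\<forall>l u v. lt (l # u) (l # v) \<longleftrightarrow> lt (u @ [l]) (v @ [l])) \<and>
     (\<forall>l u v. lt (l # u) (v @ [flip l]) \<longleftrightarrow> lt (u @ [l]) (flip l # v))"

lemma word_order_conversep: "word_order lt \<Longrightarrow> word_order (\<lambda>u v. lt v u)"
proof -
  assume lt: "word_order lt"
  have "lt (v @ [flip l]) (l # u) \<longleftrightarrow> lt (flip l # v) (u @ [l])" for l u v
    using lt unfolding word_order_def by (metis (no_types) flip_flip)
  then show ?thesis using lt unfolding word_order_def by blast
qed

text \<open>Words are compared by the sign of the lowest term of the difference of their expansions.
  Totality on reduced words is injectivity of the expansion.\<close>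

theorem word_order_exists: "\<exists>lt :: ('x \<times> bool) list \<Rightarrow> ('x \<times> bool) list \<Rightarrow> bool. word_order lt"
proof -
  obtain r :: "('x list \<times> 'x list) set" where wo: "well_order_on UNIV r"
    using well_order_on by blast
  define lt where "lt u v = leading_pos r (\<lambda>m. magnus v m - magnus u m)" for u v :: "('x \<times> bool) list"
  have irrefl: "\<not> lt u u" for u by (simp add: lt_def leading_pos_def)
  have trans: "lt u w" if "lt u v" "lt v w" for u v w
    using leading_pos_add[OF wo, of "\<lambda>m. magnus v m - magnus u m" "\<lambda>m. magnus w m - magnus v m"] that
    by (simp add: lt_def)
  have total: "lt u v \<or> lt v u" if "reduced u" "reduced v" "u \<noteq> v" for u v
    using leading_pos_total[OF wo, of "magnus u" "magnus v"] magnus_inject[of u v] that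
    by (auto simp: lt_def)
  have right: "lt (u @ [l]) (v @ [l]) \<longleftrightarrow> lt u v" for u v l
    unfolding lt_def magnus_snoc
    by (rule leading_pos_diff_iff[OF wo]) (auto simp: leading_pos_rmul[OF wo] rmul_diff)
  have cong: "lt u v \<longleftrightarrow> lt u' v'" if "magnus u = magnus u'" "magnus v = magnus v'" for u v u' v'
    using that by (simp add: lt_def)
  have left: "lt (l # u) (l # v) \<longleftrightarrow> lt u v" for u v l
  proof -
    have pos: "lt ((x, True) # u) ((x, True) # v) \<longleftrightarrow> lt u v" for x u v
      unfolding lt_def magnus_Cons_pos
      by (rule leading_pos_diff_iff[OF wo]) (auto simp: leading_pos_lmul[OF wo] lmul_diff)
    show ?thesis
    proof (cases "snd l")
      case True
      then have "l = (fst l, True)" by (simp add: prod_eq_iff)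
      then show ?thesis using pos by metis
    next
      case False
      then have l: "flip l = (fst l, True)" by (simp add: prod_eq_iff flip_def)
      \<comment> \<open>\<open>lmul\<close> handles positive letters only, so for an inverse letter
        \<open>l\<close> both sides are first prefixed with the cancelling pair
        \<open>flip l\<close>, \<open>l\<close>.\<close>
      have "lt u v \<longleftrightarrow> lt (flip l # l # u) (flip l # l # v)"
        using magnus_cancel[of "[]" "flip l"] by (intro cong) simp_all
      then show ?thesis using pos l by metis
    qed
  qed
  have "lt (l # u) (v @ [flip l]) \<longleftrightarrow> lt (u @ [l]) (flip l # v)" for l u v
  proof -
    \<comment> \<open>After multiplication by \<open>l\<close> on the right, the second word reduces
      to \<open>v\<close>, which is rewritten as \<open>l # flip l # v\<close> to produce a common
      left factor.\<close>
    have "lt (l # u) (v @ [flip l]) \<longleftrightarrow> lt ((l # u) @ [l]) ((v @ [flip l]) @ [l])" by (rule right[symmetric])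
    also have "\<dots> \<longleftrightarrow> lt (l # (u @ [l])) (l # flip l # v)"
      using magnus_cancel[of v "flip l" "[]"] magnus_cancel[of "[]" l v] by (intro cong) simp_all
    finally show ?thesis using left by simp
  qed
  then have "word_order lt" unfolding word_order_def using irrefl trans total left right by blast
  then show ?thesis by blast
qed

section \<open>Edge paths in a graph with a letter action\<close>

definition letter :: "('x \<times> bool) list \<Rightarrow> nat \<Rightarrow> 'x \<times> bool" where
  "letter w i = w ! (i mod length w)"

lemma letter_less: "i < length w \<Longrightarrow> letter w i = w ! i"
  by (simp add: letter_def)

lemma map_letter [simp]: "map (letter w) [0..<length w] = w"
  by (rule nth_equalityI) (auto simp: letter_less)

lemma letter_rotate: "w \<noteq> [] \<Longrightarrow> letter (rotate i w) j = letter w (i + j)"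
  by (simp add: letter_def nth_rotate mod_simps)

lemma letter_add_mult [simp]: "letter w (i + k * length w) = letter w i"
  by (simp add: letter_def)

text \<open>Positions are natural numbers, so reflection takes place inside \<open>k\<close>
  periods, with \<open>k\<close> as large as the position requires.\<close>

lemma letter_inv_word:
  assumes "i < k * length w"
  shows "letter (inv_word w) i = flip (letter w (k * length w - Suc i))"
proof -
  let ?l = "length w"
  have l: "0 < ?l" using assms by (cases w) auto
  define a m where "a = i div ?l" and "m = i mod ?l"
  have i: "i = a * ?l + m" and m: "m < ?l" using l by (simp_all add: a_def m_def)
  have "a < k" using assms l by (simp add: a_def less_mult_imp_div_less)
  then have "k * ?l = (k - Suc a) * ?l + Suc a * ?l"
    by (metis Suc_leI add_mult_distrib le_add_diff_inverse2)
  then have "k * ?l - Suc i = (k - Suc a) * ?l + (?l - Suc m)"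
    using m by (simp add: i)
  moreover have "?l - Suc m < ?l" using l by simp
  ultimately have "(k * ?l - Suc i) mod ?l = ?l - Suc m" by simp
  then show ?thesis using m l
    by (simp add: letter_def m_def[symmetric] inv_word_def rev_nth)
qed

lemma rotate_letter:
  assumes "w \<noteq> []"
  obtains z where "rotate i w = letter w i # z" "rotate (Suc i) w = z @ [letter w i]"
proof -
  have "hd (rotate i w) = letter w i" "rotate i w \<noteq> []"
    using assms by (simp_all add: hd_rotate_conv_nth letter_def)
  then obtain z where "rotate i w = letter w i # z" by (metis list.collapse)
  then show ?thesis using that[of z] by simp
qed

locale letter_action =
  fixes act :: "'v \<Rightarrow> 'x \<times> bool \<Rightarrow> 'v"
  assumes act_flip [simp]: "act (act v l) (flip l) = v"
begin

abbreviation path :: "'v \<Rightarrow> ('x \<times> bool) list \<Rightarrow> 'v" where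
  "path \<equiv> foldl act"

text \<open>Geometric edges, named by the origin and label of their positive orientation, so that
  both directions of travel give the same edge.\<close>

definition edge :: "'v \<Rightarrow> 'x \<times> bool \<Rightarrow> 'v \<times> 'x" where
  "edge v l = (if snd l then (v, fst l) else (act v l, fst l))"

text \<open>The 1-cochain modulo 2 given by \<open>D\<close>, evaluated on a path. Both directions
  count alike, which makes it invariant under free reduction.\<close>

primrec par :: "('v \<times> 'x) set \<Rightarrow> 'v \<Rightarrow> ('x \<times> bool) list \<Rightarrow> bool" where
  "par D v [] \<longleftrightarrow> False"
| "par D v (l # w) \<longleftrightarrow> (edge v l \<in> D) \<noteq> par D (act v l) w"

lemma act_flip' [simp]: "act (act v (flip l)) l = v"
  using act_flip[of v "flip l"] by simp

lemma act_inject [simp]: "act v l = act v' l \<longleftrightarrow> v = v'"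
  by (metis act_flip)

lemma path_inject [simp]: "path v w = path v' w \<longleftrightarrow> v = v'"
  by (induction w arbitrary: v v') auto

lemma path_inv_word [simp]: "path (path v w) (inv_word w) = v"
  by (induction w arbitrary: v) auto

lemma edge_flip [simp]: "edge (act v l) (flip l) = edge v l"
  by (auto simp: edge_def)

lemma edge_eqE:
  assumes "edge v l = edge v' l'"
  obtains "v' = v" "l' = l" | "v' = act v l" "l' = flip l"
proof -
  have "l' = l \<or> l' = flip l"
    using assms by (intro fst_eq_flip_cases) (auto simp: edge_def split: if_splits)
  then show ?thesis
  proof
    assume "l' = l"
    then show ?thesis using assms that(1) by (auto simp: edge_def split: if_splits)
  next
    assume l: "l' = flip l"
    then have "v' = act v l" using assms
      by (cases "snd l") (auto simp: edge_def)
    then show ?thesis using l that(2) by blast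
  qed
qed

lemma edge_ends:
  assumes "edge v l = (u, x)"
  shows "{u, act u (x, True)} = {v, act v l}"
proof (cases "snd l")
  case True
  then have "l = (x, True)" "u = v" using assms by (auto simp: edge_def prod_eq_iff)
  then show ?thesis by simp
next
  case False
  then have "(x, True) = flip l" "u = act v l" using assms by (auto simp: edge_def flip_def)
  then show ?thesis by auto
qed

lemma par_append [simp]: "par D v (u @ w) \<longleftrightarrow> par D v u \<noteq> par D (path v u) w"
  by (induction u arbitrary: v) auto

lemma par_red [simp]: "par D v (red w) = par D v w"
  by (rule red_invariant) auto

lemma par_inv_word [simp]: "par D (path v w) (inv_word w) = par D v w"
  by (induction w arbitrary: v) auto

lemma par_sym_diff: "par (sym_diff D D') v w \<longleftrightarrow> par D v w \<noteq> par D' v w"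
  by (induction w arbitrary: v) auto

definition vert :: "'v \<Rightarrow> ('x \<times> bool) list \<Rightarrow> nat \<Rightarrow> 'v" where
  "vert v w i = path v (map (letter w) [0..<i])"

definition edge_at :: "'v \<Rightarrow> ('x \<times> bool) list \<Rightarrow> nat \<Rightarrow> 'v \<times> 'x" where
  "edge_at v w i = edge (vert v w i) (letter w i)"

lemma vert_0 [simp]: "vert v w 0 = v"
  and vert_Suc: "vert v w (Suc i) = act (vert v w i) (letter w i)"
  by (simp_all add: vert_def)

lemma vert_rotate: "w \<noteq> [] \<Longrightarrow> vert (vert v w i) (rotate i w) j = vert v w (i + j)"
  by (induction j) (simp_all add: vert_Suc letter_rotate)

lemma vert_mult_length: "vert v w (k * length w) = path v (concat (replicate k w))"
proof (cases "w = []")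
  case False
  then show ?thesis
  proof (induction k arbitrary: v)
    case (Suc k)
    have "vert v w (Suc k * length w) = vert (vert v w (length w)) (rotate (length w) w) (k * length w)"
      by (subst vert_rotate) (simp_all add: Suc.prems)
    also have "\<dots> = vert (path v w) w (k * length w)"
      by (simp add: vert_def)
    finally show ?case using Suc by simp
  qed simp
qed simp

lemma par_positions:
  "par D v (map (letter w) [0..<n]) \<longleftrightarrow> odd (card {i. i < n \<and> edge_at v w i \<in> D})"
proof (induction n)
  case (Suc n)
  have "{i. i < Suc n \<and> edge_at v w i \<in> D} =
    (if edge_at v w n \<in> D then insert n {i. i < n \<and> edge_at v w i \<in> D}
     else {i. i < n \<and> edge_at v w i \<in> D})"
    by (auto simp: less_Suc_eq)
  then show ?case using Suc by (auto simp: edge_at_def vert_def)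
qed simp

lemma edge_at_eqE:
  assumes "edge_at v w i = edge_at v' w' j"
  obtains "vert v' w' j = vert v w i" "letter w' j = letter w i" "vert v' w' (Suc j) = vert v w (Suc i)"
  | "vert v' w' j = vert v w (Suc i)" "letter w' j = flip (letter w i)" "vert v' w' (Suc j) = vert v w i"
  using assms unfolding edge_at_def
  by (rule edge_eqE) (simp_all add: vert_Suc)

end

section \<open>Loops in the coset graph\<close>

text \<open>Translation modulo \<open>n\<close> is injective on a period. It lets one count of bad
  windows serve for neighbouring windows too.\<close>

lemma card_shift_le:
  assumes "\<And>k. Q (k mod n) \<longleftrightarrow> Q k"
  shows "card {k. k < n \<and> Q (k + j)} \<le> card {k :: nat. k < n \<and> Q k}"
proof (rule card_inj_on_le[where f = "\<lambda>k. (k + j) mod n"])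
  show "inj_on (\<lambda>k. (k + j) mod n) {k. k < n \<and> Q (k + j)}"
  proof (rule inj_onI)
    fix x y assume *: "x \<in> {k. k < n \<and> Q (k + j)}" "y \<in> {k. k < n \<and> Q (k + j)}"
      "(x + j) mod n = (y + j) mod n"
    have eq: "a = b" if "a \<le> b" "b < n" "(b + j) mod n = (a + j) mod n" for a b
    proof -
      have "n dvd (b + j) - (a + j)" using that by (subst mod_eq_dvd_iff_nat[symmetric]) auto
      then show ?thesis using that by (auto dest!: dvd_imp_le)
    qed
    show "x = y"
    proof (cases "x \<le> y")
      case True
      show ?thesis by (rule eq) (use True * in simp_all)
    next
      case False
      show ?thesis by (rule eq[symmetric]) (use False * in simp_all)
    qed
  qed
qed (auto simp: assms)

text \<open>\<open>\<Phi> D\<close> stands for the values, on a basis \<open>Y\<close> of the fundamental group, of the homomorphism to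
  \<open>\<int>/2\<close> that counts passages through the edges in \<open>D\<close>.\<close>

locale coset_graph = letter_action act
  for act :: "'v \<Rightarrow> 'x \<times> bool \<Rightarrow> 'v" +
  fixes V :: "'v set" and X :: "'x set" and v0 :: 'v and Y :: "'y set"
    and \<Phi> :: "('v \<times> 'x) set \<Rightarrow> 'y set"
  assumes act_closed: "v \<in> V \<Longrightarrow> fst l \<in> X \<Longrightarrow> act v l \<in> V"
    and connected: "v \<in> V \<Longrightarrow> \<exists>w. fst ` set w \<subseteq> X \<and> path v0 w = v"
    and base: "v0 \<in> V"
    and finite_Y: "finite Y"
    and Phi_subset: "\<Phi> D \<subseteq> Y"
    and Phi_determines: "\<Phi> D = \<Phi> D' \<Longrightarrow> v \<in> V \<Longrightarrow> fst ` set w \<subseteq> X \<Longrightarrow> path v w = v \<Longrightarrow> par D v w = par D' v w"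
begin

text \<open>A set \<open>D\<close> of edges is recovered from \<open>\<Phi> D\<close> and its
  parities along chosen paths from \<open>v0\<close> to the vertices in \<open>W\<close>. Comparing
  the numbers of possibilities gives the Euler characteristic bound.\<close>

lemma card_edges_le:
  assumes "finite E" "E \<subseteq> V \<times> X" "finite W"
    and ends: "\<And>v x. (v, x) \<in> E \<Longrightarrow> v \<in> W \<and> act v (x, True) \<in> W"
  shows "card E \<le> card W + card Y"
proof -
  obtain p where p: "\<And>v. v \<in> V \<Longrightarrow> fst ` set (p v) \<subseteq> X \<and> path v0 (p v) = v"
    using connected by metis
  define f where "f D = (\<Phi> D, {v \<in> W. par D v0 (p v)})" for D
  have "inj_on f (Pow E)"
  proof (rule inj_onI)
    fix D D' assume D: "D \<in> Pow E" "D' \<in> Pow E" and eq: "f D = f D'"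
    have "(v, x) \<in> D \<longleftrightarrow> (v, x) \<in> D'" if e: "(v, x) \<in> E" for v x
    proof -
      let ?u = "act v (x, True)"
      \<comment> \<open>The closed path out to \<open>v\<close>, across the edge and back. Its
        parity and those of the two chosen paths decide whether the edge lies in
        \<open>D\<close>.\<close>
      let ?w = "p v @ (x, True) # inv_word (p ?u)"
      have vx: "v \<in> V" "x \<in> X" "v \<in> W" "?u \<in> W" using e ends assms(2) by auto
      then have u: "?u \<in> V" using act_closed by simp
      have closing: "path ?u (inv_word (p ?u)) = v0" "par C ?u (inv_word (p ?u)) = par C v0 (p ?u)" for C
        using path_inv_word[of v0 "p ?u"] par_inv_word[of C v0 "p ?u"] p[OF u] by simp_all
      have "fst ` set ?w \<subseteq> X" "path v0 ?w = v0"
        using p[OF vx(1)] p[OF u] vx(2) closing by (simp_all add: image_Un)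
      from Phi_determines[OF _ base this, of D D']
      have "par D v0 ?w = par D' v0 ?w" using eq by (simp add: f_def)
      moreover have "par C v0 ?w \<longleftrightarrow> par C v0 (p v) \<noteq> (((v, x) \<in> C) \<noteq> par C v0 (p ?u))" for C
        using p[OF vx(1)] closing by (simp add: edge_def)
      moreover have "par D v0 (p v) = par D' v0 (p v)" "par D v0 (p ?u) = par D' v0 (p ?u)"
        using eq vx by (auto simp: f_def)
      ultimately show ?thesis by metis
    qed
    then show "D = D'" using D by auto
  qed
  moreover have "f ` Pow E \<subseteq> Pow Y \<times> Pow W"
    using Phi_subset by (auto simp: f_def)
  ultimately have "card (Pow E) \<le> card (Pow Y \<times> Pow W)"
    by (intro card_inj_on_le) (auto simp: finite_Y assms(3))
  then have "(2::nat) ^ card E \<le> 2 ^ (card W + card Y)"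
    using assms(1,3) finite_Y by (simp add: card_cartesian_product card_Pow power_add mult.commute)
  then show ?thesis by simp
qed

text \<open>The last clause makes \<open>n\<close> the exact period of \<open>w\<close> at
  \<open>v\<close>. As \<open>letter\<close> is periodic, the clause on consecutive letters
  expresses cyclic reducedness.\<close>

definition loop :: "'v \<Rightarrow> ('x \<times> bool) list \<Rightarrow> nat \<Rightarrow> bool" where
  "loop v w n \<longleftrightarrow> v \<in> V \<and> fst ` set w \<subseteq> X \<and> rot_primitive w \<and>
     (\<forall>i. letter w (Suc i) \<noteq> flip (letter w i)) \<and>
     0 < n \<and> (\<forall>k. vert v w (k * length w) = v \<longleftrightarrow> n dvd k)"

lemma loop_period_unique: "loop v w n \<Longrightarrow> loop v w n' \<Longrightarrow> n = n'"
  unfolding loop_def by (metis dvd_antisym dvd_refl)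

context
  fixes v w n
  assumes loop: "loop v w n"
begin

lemma nonempty [simp]: "w \<noteq> []"
  using loop by (auto simp: loop_def rot_primitive_def)

lemma length_pos [simp]: "0 < length w"
  using nonempty by blast

lemma n_pos [simp]: "0 < n"
  using loop by (simp add: loop_def)

lemma nonbacktracking: "letter w (Suc i) \<noteq> flip (letter w i)"
  using loop by (simp add: loop_def)

lemma letter_in: "fst (letter w i) \<in> X"
proof -
  have "letter w i \<in> set w" by (simp add: letter_def)
  then show ?thesis using loop by (auto simp: loop_def)
qed

lemma vert_in: "vert v w i \<in> V"
proof (induction i)
  case 0 then show ?case using loop by (simp add: loop_def)
next
  case (Suc i) then show ?case by (simp add: vert_Suc act_closed letter_in)
qed

lemma edge_at_in: "edge_at v w i \<in> V \<times> X"
  using vert_in[of i] vert_in[of "Suc i"] letter_in[of i]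
  by (auto simp: edge_at_def edge_def vert_Suc)

lemma vert_mult_add: "vert v w (k * length w + i) = path (vert v w (k * length w)) (map (letter w) [0..<i])"
proof -
  have "rotate (k * length w) w = w" by (rule rotate_id) simp
  then show ?thesis
    using vert_rotate[of w v "k * length w" i] by (simp add: vert_def)
qed

lemma vert_mult_eq: "vert v w (k * length w + i) = vert v w i \<longleftrightarrow> n dvd k"
proof -
  have "vert v w (k * length w + i) = vert v w i \<longleftrightarrow> vert v w (k * length w) = v"
    unfolding vert_mult_add by (simp add: vert_def)
  then show ?thesis using loop by (simp add: loop_def)
qed

lemma loop_rotate: "loop (vert v w i) (rotate i w) n"
  unfolding loop_def
proof (intro conjI allI)
  show "rot_primitive (rotate i w)" using loop by (simp add: loop_def rot_primitive_rotate)
  show "letter (rotate i w) (Suc j) \<noteq> flip (letter (rotate i w) j)" for j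
    using nonbacktracking[of "i + j"] by (simp add: letter_rotate)
  show "(vert (vert v w i) (rotate i w) (k * length (rotate i w)) = vert v w i) \<longleftrightarrow> n dvd k" for k
    using vert_mult_eq[of k i] by (simp add: vert_rotate add.commute)
qed (use vert_in loop in \<open>auto simp: loop_def\<close>)

lemma vert_mod [simp]: "vert v w (i mod (n * length w)) = vert v w i"
proof -
  have "vert v w i = vert v w ((i div (n * length w) * n) * length w + i mod (n * length w))"
    by (metis div_mult_mod_eq mult.assoc)
  also have "\<dots> = vert v w (i mod (n * length w))"
    by (rule iffD2[OF vert_mult_eq]) simp
  finally show ?thesis ..
qed

lemma mod_mod_length: "i mod (n * length w) mod length w = i mod length w"
  by (simp add: mod_mod_cancel)

lemma letter_mod [simp]: "letter w (i mod (n * length w)) = letter w i"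
  by (simp add: letter_def mod_mod_length)

lemma rotate_mod [simp]: "rotate (i mod (n * length w)) w = rotate i w"
  by (metis mod_mod_length rotate_conv_mod)

lemma edge_at_mod [simp]: "edge_at v w (i mod (n * length w)) = edge_at v w i"
  by (simp add: edge_at_def)

text \<open>By primitivity equal rotations put the positions a whole number of periods apart, and
  equal vertices make this number a multiple of \<open>n\<close>.\<close>

lemma position_eq:
  assumes "vert v w i = vert v w j" "rotate i w = rotate j w"
  shows "i mod (n * length w) = j mod (n * length w)"
proof -
  have *: "j mod (n * length w) = i mod (n * length w)"
    if ij: "i \<le> j" and eq: "vert v w i = vert v w j" "rotate i w = rotate j w" for i j
  proof -
    have "j mod length w = i mod length w"
      using rotate_primitive_eq[OF _ eq(2)] loop by (simp add: loop_def)
    then obtain k where k: "j - i = length w * k"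
      using ij by (metis dvdE mod_eq_dvd_iff_nat)
    then have j: "j = k * length w + i" using ij by (simp add: mult.commute)
    then have "n dvd k" using eq(1) vert_mult_eq[of k i] by simp
    then have "n * length w dvd j - i" using j by simp
    then show ?thesis using ij mod_eq_dvd_iff_nat by blast
  qed
  show ?thesis
  proof (cases "i \<le> j")
    case True
    show ?thesis by (rule *[OF True assms, symmetric])
  next
    case False
    then show ?thesis using *[of j i] assms by simp
  qed
qed

lemma reduced_rotate: "reduced (rotate i w)"
  unfolding successively_conv_nth
proof (intro allI impI)
  fix j assume "Suc j < length (rotate i w)"
  then show "rotate i w ! Suc j \<noteq> flip (rotate i w ! j)"
    using nonbacktracking[of "i + j"] letter_rotate[OF nonempty, of i j] letter_rotate[OF nonempty, of i "Suc j"]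
    by (simp add: letter_less)
qed

lemma vert_inv_word:
  assumes "i \<le> k * n * length w"
  shows "vert v (inv_word w) i = vert v w (k * n * length w - i)"
  using assms
proof (induction i)
  case 0
  then show ?case using vert_mult_eq[of "k * n" 0] by simp
next
  case (Suc i)
  define j where "j = k * n * length w - Suc i"
  have j: "k * n * length w - i = Suc j" using Suc.prems by (simp add: j_def)
  have "letter (inv_word w) i = flip (letter w j)"
    using letter_inv_word[of i "k * n" w] Suc.prems by (simp add: j_def)
  then show ?case using Suc by (simp add: vert_Suc j j_def[symmetric])
qed

text \<open>Reading a loop backwards lets a passage through an edge in the opposite direction be
  treated as a forward one.\<close>

lemma loop_inv_word: "loop v (inv_word w) n"
  unfolding loop_def
proof (intro conjI allI)
  show "rot_primitive (inv_word w)" using loop by (simp add: loop_def rot_primitive_inv_word)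
  show "letter (inv_word w) (Suc i) \<noteq> flip (letter (inv_word w) i)" for i
  proof -
    \<comment> \<open>Reflection in \<open>i + 2\<close> periods leaves room for both positions
      \<open>i\<close> and \<open>Suc i\<close>.\<close>
    define j where "j = (i + 2) * length w - Suc (Suc i)"
    have "(i + 2) * 1 \<le> (i + 2) * length w"
      using length_pos by (intro mult_le_mono2) linarith
    then have j: "Suc i < (i + 2) * length w" "(i + 2) * length w - Suc i = Suc j"
      by (auto simp: j_def)
    have "letter (inv_word w) (Suc i) = flip (letter w j)"
      unfolding j_def by (rule letter_inv_word[OF j(1)])
    moreover have "letter (inv_word w) i = flip (letter w (Suc j))"
      unfolding j(2)[symmetric] by (rule letter_inv_word) (use j(1) in linarith)
    ultimately show ?thesis using nonbacktracking[of j] by simp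
  qed
  show "(vert v (inv_word w) (k * length (inv_word w)) = v) \<longleftrightarrow> n dvd k" for k
  proof -
    have "k * length w \<le> k * n * length w" by (simp add: Suc_le_eq)
    then have "vert v (inv_word w) (k * length w) = vert v w (k * n * length w - k * length w)"
      by (rule vert_inv_word)
    also have "\<dots> = vert v w ((k * n - k) * length w + 0)" by (simp add: diff_mult_distrib)
    finally have "vert v (inv_word w) (k * length w) = v \<longleftrightarrow> n dvd k * n - k"
      using vert_mult_eq[of "k * n - k" 0] by simp
    also have "\<dots> \<longleftrightarrow> n dvd k"
    proof -
      have "k * n - k + k = k * n" using n_pos by (cases n) auto
      then show ?thesis by (metis dvd_add_right_iff dvd_add_left_iff dvd_triv_right)
    qed
    finally show ?thesis by simp
  qed
qed (use loop in \<open>auto simp: loop_def\<close>)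

section \<open>Stacking the positions over each vertex\<close>

context
  fixes lt :: "('x \<times> bool) list \<Rightarrow> ('x \<times> bool) list \<Rightarrow> bool"
  assumes lt: "word_order lt"
begin

text \<open>The height of a position is its rotation of \<open>w\<close>. A tie over one vertex
  means the same position on the loop, by \<open>position_eq\<close>.\<close>

definition topmost :: "nat \<Rightarrow> bool" where
  "topmost i \<longleftrightarrow> (\<forall>j. vert v w j = vert v w i \<longrightarrow> \<not> lt (rotate i w) (rotate j w))"

lemma topmost_mod [simp]: "topmost (i mod (n * length w)) \<longleftrightarrow> topmost i"
  by (simp add: topmost_def)

lemma lt_total: "\<not> lt (rotate i w) (rotate j w) \<Longrightarrow> \<not> lt (rotate j w) (rotate i w) \<Longrightarrow> rotate i w = rotate j w"
  using lt reduced_rotate[of i] reduced_rotate[of j] unfolding word_order_def by blast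

text \<open>One step conjugates the rotation by the letter passed, so two steps along the same
  letter preserve the order.\<close>

lemma lt_Suc:
  assumes "letter w i = letter w j"
  shows "lt (rotate (Suc i) w) (rotate (Suc j) w) \<longleftrightarrow> lt (rotate i w) (rotate j w)"
proof -
  obtain y where y: "rotate i w = letter w i # y" "rotate (Suc i) w = y @ [letter w i]"
    using rotate_letter[OF nonempty] by blast
  obtain z where z: "rotate j w = letter w j # z" "rotate (Suc j) w = z @ [letter w j]"
    using rotate_letter[OF nonempty] by blast
  show ?thesis using lt unfolding y z assms word_order_def by blast
qed

text \<open>For opposite directions, the start of one step is compared with the end of the other;
  again both rotations are conjugated by the same letter.\<close>

lemma lt_Suc_flip:
  assumes "letter w j = flip (letter w i)"
  shows "lt (rotate (Suc i) w) (rotate j w) \<longleftrightarrow> lt (rotate i w) (rotate (Suc j) w)"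
proof -
  obtain y where y: "rotate i w = letter w i # y" "rotate (Suc i) w = y @ [letter w i]"
    using rotate_letter[OF nonempty] by blast
  obtain z where z: "rotate j w = letter w j # z" "rotate (Suc j) w = z @ [letter w j]"
    using rotate_letter[OF nonempty] by blast
  show ?thesis using lt unfolding y z assms word_order_def by blast
qed

lemma ex_topmost: "\<exists>j < n * length w. vert v w j = vert v w i \<and> topmost j"
proof -
  define J where "J = {j. j < n * length w \<and> vert v w j = vert v w i}"
  have "i mod (n * length w) \<in> J" by (simp add: J_def)
  then have "J \<noteq> {}" by blast
  have "finite J" by (simp add: J_def)
  have "asymp_on J (\<lambda>i j. lt (rotate i w) (rotate j w))"
    "transp_on J (\<lambda>i j. lt (rotate i w) (rotate j w))"
    using lt unfolding word_order_def asymp_on_def transp_on_def by blast+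
  then obtain m where m: "m \<in> J" "\<And>j. j \<in> J \<Longrightarrow> j \<noteq> m \<Longrightarrow> \<not> lt (rotate m w) (rotate j w)"
    using Finite_Set.bex_max_element[of J "\<lambda>i j. lt (rotate i w) (rotate j w)"]
      \<open>finite J\<close> \<open>J \<noteq> {}\<close> by blast
  have "\<not> lt (rotate m w) (rotate j w)" if "vert v w j = vert v w m" for j
  proof -
    have "j mod (n * length w) \<in> J" using that m(1) by (simp add: J_def)
    then have "\<not> lt (rotate m w) (rotate (j mod (n * length w)) w)"
      using m(2) lt unfolding word_order_def by blast
    then show ?thesis by simp
  qed
  then have "topmost m" by (simp add: topmost_def)
  then show ?thesis using m(1) by (auto simp: J_def)
qed

text \<open>Conjugation carries the comparison from one end of the edge to the other, so a passage
  that is topmost at either end is not below the other passage. As this holds both ways, the heights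
  agree.\<close>

lemma topmost_edge_unique:
  assumes "edge_at v w i = edge_at v w j" "topmost i \<or> topmost (Suc i)" "topmost j \<or> topmost (Suc j)"
  shows "i mod (n * length w) = j mod (n * length w)"
  using assms(1)
proof (rule edge_at_eqE)
  assume *: "vert v w j = vert v w i" "letter w j = letter w i" "vert v w (Suc j) = vert v w (Suc i)"
  have "\<not> lt (rotate i w) (rotate j w)" "\<not> lt (rotate j w) (rotate i w)"
    using assms(2,3) * lt_Suc[of i j] lt_Suc[of j i] unfolding topmost_def by metis+
  then show ?thesis using * by (intro position_eq lt_total) auto
next
  assume *: "vert v w j = vert v w (Suc i)" "letter w j = flip (letter w i)" "vert v w (Suc j) = vert v w i"
  then have eq': "letter w i = flip (letter w j)" by simp
  have "\<not> lt (rotate i w) (rotate (Suc j) w)" "\<not> lt (rotate (Suc j) w) (rotate i w)"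
    using assms(2,3) * lt_Suc_flip[OF *(2)] lt_Suc_flip[OF eq'] unfolding topmost_def by metis+
  \<comment> \<open>Opposite passages at equal height would make the letter after position
    \<open>j\<close> undo the letter at \<open>j\<close>.\<close>
  then have "rotate i w = rotate (Suc j) w" by (rule lt_total)
  then have "letter w i = letter w (Suc j)"
    using letter_rotate[OF nonempty, of i 0] letter_rotate[OF nonempty, of "Suc j" 0] by simp
  then show ?thesis using nonbacktracking[of j] eq' by simp
qed

text \<open>Along the loop, the topmost positions form arcs; each arc has one more edge than it has vertices,
  so the Euler characteristic bounds the number of arcs.\<close>

lemma card_arcs_le: "card {i. i < n * length w \<and> \<not> topmost i \<and> topmost (Suc i)} \<le> card Y"
proof -
  let ?P = "n * length w"
  let ?T = "{i. i < ?P \<and> topmost i}" and ?R = "{i. i < ?P \<and> (topmost i \<or> topmost (Suc i))}"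
  let ?W = "vert v w ` {..<?P}"
  \<comment> \<open>Every vertex has a topmost position over it, so there are no more vertices than
    topmost positions. The edges of \<open>?R\<close> are distinct, so the Euler bound limits the
    excess of \<open>?R\<close> over \<open>?T\<close>.\<close>
  have "card ?W \<le> card (vert v w ` ?T)"
  proof (rule card_mono)
    show "?W \<subseteq> vert v w ` ?T"
    proof
      fix u assume "u \<in> ?W"
      then obtain i where "u = vert v w i" by blast
      moreover obtain j where "j < ?P" "vert v w j = vert v w i" "topmost j" using ex_topmost by blast
      ultimately show "u \<in> vert v w ` ?T" by (intro image_eqI[of _ _ j]) auto
    qed
  qed simp
  also have "\<dots> \<le> card ?T" by (rule card_image_le) simp
  finally have W: "card ?W \<le> card ?T" .
  have "inj_on (edge_at v w) ?R"
    by (rule inj_onI) (use topmost_edge_unique in fastforce)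
  then have "card ?R = card (edge_at v w ` ?R)" by (simp add: card_image)
  also have "\<dots> \<le> card ?W + card Y"
  proof (rule card_edges_le)
    show "edge_at v w ` ?R \<subseteq> V \<times> X" using edge_at_in by blast
    fix u x assume "(u, x) \<in> edge_at v w ` ?R"
    then obtain i where i: "edge_at v w i = (u, x)" by force
    have vW: "vert v w j \<in> ?W" for j
    proof -
      have "j mod ?P \<in> {..<?P}" by simp
      then show ?thesis using vert_mod[of j] by (metis imageI)
    qed
    have ends: "u \<in> {vert v w i, vert v w (Suc i)}" "act u (x, True) \<in> {vert v w i, vert v w (Suc i)}"
      using edge_ends[of "vert v w i" "letter w i" u x] i by (auto simp: edge_at_def vert_Suc)
    have "{vert v w i, vert v w (Suc i)} \<subseteq> ?W"
      unfolding insert_subset using vW by (intro conjI empty_subsetI)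
    then show "u \<in> ?W \<and> act u (x, True) \<in> ?W"
      by (intro conjI) (rule subsetD, assumption, rule ends)+
  qed simp_all
  finally have "card ?R \<le> card ?T + card Y" using W by simp
  moreover have "{i. i < ?P \<and> \<not> topmost i \<and> topmost (Suc i)} = ?R - ?T" by auto
  moreover have "card (?R - ?T) = card ?R - card ?T" by (rule card_Diff_subset) auto
  ultimately show ?thesis by simp
qed

text \<open>The largest of all rotations of \<open>w\<close> is topmost over any vertex. Its
  occurrences cut the loop into \<open>n\<close> windows of one period with topmost ends.\<close>

lemma ex_topmost_phase: "\<exists>s < length w. \<forall>i. i mod length w = s \<longrightarrow> topmost i"
proof -
  have "asymp_on {..<length w} (\<lambda>i j. lt (rotate i w) (rotate j w))"
    "transp_on {..<length w} (\<lambda>i j. lt (rotate i w) (rotate j w))"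
    using lt unfolding word_order_def asymp_on_def transp_on_def by blast+
  moreover have "{..<length w} \<noteq> {}" by (simp add: lessThan_empty_iff)
  ultimately obtain s where s: "s < length w"
    "\<And>j. j < length w \<Longrightarrow> j \<noteq> s \<Longrightarrow> \<not> lt (rotate s w) (rotate j w)"
    using Finite_Set.bex_max_element[of "{..<length w}" "\<lambda>i j. lt (rotate i w) (rotate j w)"] by auto
  have "\<not> lt (rotate s w) (rotate (j mod length w) w)" for j
    using s(2)[of "j mod length w"] lt unfolding word_order_def
    by (metis length_pos mod_less_divisor)
  then have "\<not> lt (rotate s w) (rotate j w)" for j
    by (metis rotate_conv_mod)
  then have "topmost i" if "i mod length w = s" for i
    using that unfolding topmost_def by (metis rotate_conv_mod)
  then show ?thesis using s(1) by blast
qed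

text \<open>A window containing a position that is not topmost must return to a topmost one by its
  end. The windows are disjoint, so these returns are distinct and \<open>card_arcs_le\<close>
  counts them.\<close>

lemma card_windows_le:
  assumes "\<And>k. topmost (s + k * length w)"
  shows "card {k. k < n \<and> (\<exists>i. s + k * length w \<le> i \<and> i < s + Suc k * length w \<and> \<not> topmost i)} \<le> card Y"
    (is "card ?B \<le> _")
proof -
  let ?l = "length w" and ?P = "n * length w"
  have "\<exists>i. s + k * ?l \<le> i \<and> i < s + Suc k * ?l \<and> \<not> topmost i \<and> topmost (Suc i)" if "k \<in> ?B" for k
  proof -
    from that have "\<exists>i. s + k * ?l \<le> i \<and> i < s + Suc k * ?l \<and> \<not> topmost i" unfolding mem_Collect_eq by (rule conjunct2)
    then obtain i where i: "s + k * ?l \<le> i" "i < s + Suc k * ?l" "\<not> topmost i" by (elim exE conjE)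
    \<comment> \<open>The first topmost position after \<open>i\<close>; it comes no later than the
      end of the window, which is topmost. The return is the step from \<open>j - 1\<close>.\<close>
    define j where "j = (LEAST j. i < j \<and> topmost j)"
    have ex: "i < s + Suc k * ?l \<and> topmost (s + Suc k * ?l)" by (intro conjI i(2) assms)
    have j: "i < j" "topmost j"
      using LeastI[of "\<lambda>j. i < j \<and> topmost j", OF ex] unfolding j_def by blast+
    have le: "j \<le> s + Suc k * ?l" unfolding j_def by (rule Least_le) (rule ex)
    have "\<not> topmost (j - 1)"
    proof (cases "j - 1 = i")
      case False
      then have "j - 1 < j" "i < j - 1" using j by auto
      then show ?thesis using not_less_Least[of "j - 1" "\<lambda>j. i < j \<and> topmost j"] unfolding j_def by blast
    qed (use i(3) in simp)
    then show ?thesis using i j le by (intro exI[of _ "j - 1"]) auto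
  qed
  then have "\<forall>k\<in>?B. \<exists>i. s + k * ?l \<le> i \<and> i < s + Suc k * ?l \<and> \<not> topmost i \<and> topmost (Suc i)"
    by (rule ballI)
  from bchoice[OF this] obtain f where
    f': "\<forall>k\<in>?B. s + k * ?l \<le> f k \<and> f k < s + Suc k * ?l \<and> \<not> topmost (f k) \<and> topmost (Suc (f k))" ..
  have f: "s + k * ?l \<le> f k \<and> f k < s + Suc k * ?l \<and> \<not> topmost (f k) \<and> topmost (Suc (f k))"
    if "k \<in> ?B" for k by (rule bspec[OF f' that])
  have "card ?B \<le> card {i. i < ?P \<and> \<not> topmost i \<and> topmost (Suc i)}"
  proof (rule card_inj_on_le[where f = "\<lambda>k. f k mod ?P"])
    show "(\<lambda>k. f k mod ?P) ` ?B \<subseteq> {i. i < ?P \<and> \<not> topmost i \<and> topmost (Suc i)}"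
    proof (rule image_subsetI)
      fix k assume k: "k \<in> ?B"
      have "topmost (Suc (f k mod ?P))"
        using f[OF k] topmost_mod[of "Suc (f k)"] topmost_mod[of "Suc (f k mod ?P)"] by (simp add: mod_Suc_eq)
      then show "f k mod ?P \<in> {i. i < ?P \<and> \<not> topmost i \<and> topmost (Suc i)}"
        using f[OF k] by simp
    qed
    show "inj_on (\<lambda>k. f k mod ?P) ?B"
    proof (rule inj_onI)
      fix a b assume ab: "a \<in> ?B" "b \<in> ?B" "f a mod ?P = f b mod ?P"
      have bound: "f k - s < ?P \<and> (f k - s) div ?l = k" if "k \<in> ?B" for k
      proof -
        have "f k - s < Suc k * ?l" "k * ?l \<le> f k - s" using f[OF that] by auto
        moreover have "Suc k * ?l \<le> ?P" using that by (intro mult_le_mono1) auto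
        ultimately show ?thesis by (auto intro!: div_nat_eqI simp: mult.commute)
      qed
      have eq: "f a = f b" if "f a \<le> f b" "a \<in> ?B" "b \<in> ?B" "f b mod ?P = f a mod ?P" for a b
      proof (rule ccontr)
        assume "f a \<noteq> f b"
        then have "0 < f b - f a" using that(1) by simp
        moreover have "?P dvd f b - f a" using that by (simp add: mod_eq_dvd_iff_nat)
        ultimately have "?P \<le> f b - f a" by (rule dvd_imp_le[rotated])
        then show False using bound[OF that(3)] f[OF that(2)] by linarith
      qed
      have "f a = f b"
      proof (cases "f a \<le> f b")
        case True
        show ?thesis by (rule eq) (use True ab in simp_all)
      next
        case False
        show ?thesis by (rule eq[symmetric]) (use False ab in simp_all)
      qed
      then have "(f a - s) div ?l = (f b - s) div ?l" by (rule arg_cong)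
      then show "a = b"
        unfolding bound[OF ab(1), THEN conjunct2] bound[OF ab(2), THEN conjunct2] .
    qed
  qed simp
  then show ?thesis using card_arcs_le by linarith
qed

end

section \<open>Stretches of vertices that are visited once\<close>

definition visited_once :: "nat \<Rightarrow> bool" where
  "visited_once i \<longleftrightarrow> (\<forall>j. vert v w j = vert v w i \<longrightarrow> j mod (n * length w) = i mod (n * length w))"

lemma visited_once_mod [simp]: "visited_once (i mod (n * length w)) \<longleftrightarrow> visited_once i"
  by (simp add: visited_once_def)

text \<open>Positions both topmost and lowest are visited once. At most \<open>card Y\<close>
  windows fail to be topmost throughout, at most \<open>card Y\<close> fail to be lowest throughout,
  and at most \<open>card C\<close> periods meet \<open>C\<close> at a position visited once. A long
  loop therefore has two consecutive good periods.\<close>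

lemma ex_run:
  assumes "finite C" "card C \<le> 2 * card Y" "10 * card Y < n"
  shows "\<exists>s. \<forall>i < 2 * length w. visited_once (s + i) \<and> vert v w (s + i) \<notin> C"
proof -
  let ?l = "length w" and ?P = "n * length w" and ?r = "card Y"
  obtain lt :: "('x \<times> bool) list \<Rightarrow> ('x \<times> bool) list \<Rightarrow> bool" where lt: "word_order lt"
    using word_order_exists by blast
  \<comment> \<open>Topmost for \<open>gt\<close> means lowest for \<open>lt\<close>.\<close>
  define gt where "gt = (\<lambda>a b. lt b a)"
  have gt: "word_order gt" unfolding gt_def by (rule word_order_conversep[OF lt])
  obtain s where s: "s < ?l" "\<And>i. i mod ?l = s \<Longrightarrow> topmost lt i"
    using ex_topmost_phase[OF lt] by blast
  obtain t where t: "t < ?l" "\<And>i. i mod ?l = t \<Longrightarrow> topmost gt i"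
    using ex_topmost_phase[OF gt] by blast
  have once: "visited_once i" if "topmost lt i" "topmost gt i" for i
    unfolding visited_once_def
  proof (intro allI impI)
    fix j assume j: "vert v w j = vert v w i"
    have "\<not> lt (rotate i w) (rotate j w)"
      using that(1) j unfolding topmost_def[OF lt] by blast
    moreover have "\<not> gt (rotate i w) (rotate j w)"
      using that(2) j unfolding topmost_def[OF gt] by blast
    ultimately have "rotate j w = rotate i w"
      unfolding gt_def by (intro lt_total[OF lt])
    then show "j mod ?P = i mod ?P" using j by (intro position_eq) auto
  qed
  define A where "A k \<longleftrightarrow> (\<exists>i. s + k * ?l \<le> i \<and> i < s + Suc k * ?l \<and> \<not> topmost lt i)" for k
  define B where "B k \<longleftrightarrow> (\<exists>i. t + k * ?l \<le> i \<and> i < t + Suc k * ?l \<and> \<not> topmost gt i)" for k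
  \<comment> \<open>With positions visited once, distinct periods meet distinct vertices of
    \<open>C\<close>.\<close>
  define D where "D k \<longleftrightarrow> (\<exists>i. 0 + k * ?l \<le> i \<and> i < 0 + Suc k * ?l \<and> (visited_once i \<and> vert v w i \<in> C))" for k
  have periodic: "(\<exists>i. c + (k mod n) * ?l \<le> i \<and> i < c + Suc (k mod n) * ?l \<and> Q i) \<longleftrightarrow>
      (\<exists>i. c + k * ?l \<le> i \<and> i < c + Suc k * ?l \<and> Q i)" if Q: "\<And>i. Q (i mod ?P) \<longleftrightarrow> Q i" for Q c k
  proof -
    define q where "q = k div n * ?P"
    have k: "k * ?l = (k mod n) * ?l + q"
      unfolding q_def by (metis add.commute add_mult_distrib div_mult_mod_eq mult.assoc)
    have Qq: "Q (i + q) \<longleftrightarrow> Q i" for i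
      using Q[of "i + q"] Q[of i] by (simp add: q_def)
    show ?thesis (is "?L \<longleftrightarrow> ?R")
    proof
      assume ?L
      then obtain i where "c + (k mod n) * ?l \<le> i" "i < c + Suc (k mod n) * ?l" "Q i" by blast
      then show ?R using k Qq by (intro exI[of _ "i + q"]) auto
    next
      assume ?R
      then obtain i where "c + k * ?l \<le> i" "i < c + Suc k * ?l" "Q i" by blast
      then show ?L using k Qq[of "i - q"] by (intro exI[of _ "i - q"]) auto
    qed
  qed
  have A: "card {k. k < n \<and> A (k + j)} \<le> ?r" for j
  proof -
    have "card {k. k < n \<and> A (k + j)} \<le> card {k. k < n \<and> A k}"
      unfolding A_def by (rule card_shift_le) (rule periodic, simp add: topmost_mod[OF lt])
    also have "\<dots> \<le> ?r" unfolding A_def using s by (intro card_windows_le[OF lt]) auto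
    finally show ?thesis .
  qed
  have B: "card {k. k < n \<and> B (k + j)} \<le> ?r" for j
  proof -
    have "card {k. k < n \<and> B (k + j)} \<le> card {k. k < n \<and> B k}"
      unfolding B_def by (rule card_shift_le) (rule periodic, simp add: topmost_mod[OF gt])
    also have "\<dots> \<le> ?r" unfolding B_def using t by (intro card_windows_le[OF gt]) auto
    finally show ?thesis .
  qed
  have D: "card {k. k < n \<and> D (k + j)} \<le> 2 * ?r" for j
  proof -
    have "card {k. k < n \<and> D (k + j)} \<le> card {k. k < n \<and> D k}"
      unfolding D_def by (rule card_shift_le) (rule periodic, simp)
    also have "\<dots> \<le> card C"
    proof -
      have "\<forall>k\<in>Collect D. \<exists>i. k * ?l \<le> i \<and> i < Suc k * ?l \<and> (visited_once i \<and> vert v w i \<in> C)"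
        unfolding D_def by simp
      from bchoice[OF this] obtain f where
        f': "\<forall>k\<in>Collect D. k * ?l \<le> f k \<and> f k < Suc k * ?l \<and> (visited_once (f k) \<and> vert v w (f k) \<in> C)" ..
      have f: "k * ?l \<le> f k \<and> f k < Suc k * ?l \<and> visited_once (f k) \<and> vert v w (f k) \<in> C"
        if "D k" for k using bspec[OF f', of k] that by simp
      have P: "f k < ?P \<and> f k div ?l = k" if "k < n" "D k" for k
      proof -
        have "Suc k * ?l \<le> ?P" using that by (intro mult_le_mono1) auto
        then show ?thesis using f[OF that(2)] by (auto intro!: div_nat_eqI simp: mult.commute)
      qed
      show ?thesis
      proof (rule card_inj_on_le[where f = "\<lambda>k. vert v w (f k)"])
        show "inj_on (\<lambda>k. vert v w (f k)) {k. k < n \<and> D k}"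
        proof (rule inj_onI)
          fix a b assume ab: "a \<in> {k. k < n \<and> D k}" "b \<in> {k. k < n \<and> D k}" "vert v w (f a) = vert v w (f b)"
          then have "f a mod ?P = f b mod ?P" using f[of b] unfolding visited_once_def by blast
          moreover have "f a < ?P" "f a div ?l = a" "f b < ?P" "f b div ?l = b"
            using P[of a] P[of b] ab by blast+
          ultimately show "a = b" by (metis mod_less)
        qed
      qed (use f assms(1) in auto)
    qed
    finally show ?thesis using assms(2) by linarith
  qed
  \<comment> \<open>Origin of the bound 10: three shifts of \<open>A\<close> and three of
    \<open>B\<close> with at most \<open>card Y\<close> values of \<open>k\<close> each, and two of
    \<open>D\<close> with at most \<open>2 * card Y\<close> each.\<close>
  let ?bad = "{k. k < n \<and> A (k + 0)} \<union> {k. k < n \<and> A (k + 1)} \<union> {k. k < n \<and> A (k + 2)} \<union>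
    {k. k < n \<and> B (k + 0)} \<union> {k. k < n \<and> B (k + 1)} \<union> {k. k < n \<and> B (k + 2)} \<union>
    {k. k < n \<and> D (k + 1)} \<union> {k. k < n \<and> D (k + 2)}"
  have Un: "card (S \<union> T) \<le> a + b" if "card S \<le> a" "card T \<le> b" for S T :: "nat set" and a b
    using card_Un_le[of S T] that by linarith
  have "card ?bad \<le> ?r + ?r + ?r + ?r + ?r + ?r + 2 * ?r + 2 * ?r"
    by (intro Un A B D)
  then have "card ?bad < card {..<n}" using assms(3) by simp
  moreover have "finite ?bad" by simp
  ultimately have "\<not> {..<n} \<subseteq> ?bad" using card_mono[of ?bad "{..<n}"] by linarith
  then obtain k where k: "k < n" "k \<notin> ?bad" by blast
  have kA: "\<not> A k" "\<not> A (Suc k)" "\<not> A (Suc (Suc k))" "\<not> B k" "\<not> B (Suc k)" "\<not> B (Suc (Suc k))"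
    "\<not> D (Suc k)" "\<not> D (Suc (Suc k))"
    using k by (simp_all add: numeral_2_eq_2)
  show ?thesis
  proof (intro exI[of _ "Suc k * ?l"] allI impI)
    fix i assume i: "i < 2 * ?l"
    define p where "p = Suc k * ?l + i"
    \<comment> \<open>The windows of phase \<open>c\<close> begin \<open>c\<close> places after the
      periods, so two consecutive periods are covered by three consecutive windows.\<close>
    have win: "p < c + Suc k * ?l \<and> c + k * ?l \<le> p \<or>
      p < c + Suc (Suc k) * ?l \<and> c + Suc k * ?l \<le> p \<or>
      p < c + Suc (Suc (Suc k)) * ?l \<and> c + Suc (Suc k) * ?l \<le> p" if "c < ?l" for c
      using that i by (auto simp: p_def)
    have "topmost lt p" using win[OF s(1)] kA(1-3) unfolding A_def by blast
    moreover have "topmost gt p" using win[OF t(1)] kA(4-6) unfolding B_def by blast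
    ultimately have "visited_once p" by (rule once)
    moreover have "p < Suc (Suc k) * ?l \<and> Suc k * ?l \<le> p \<or> p < Suc (Suc (Suc k)) * ?l \<and> Suc (Suc k) * ?l \<le> p"
      using i by (auto simp: p_def)
    ultimately have "vert v w p \<notin> C" using kA(7,8) unfolding D_def by auto
    then show "visited_once (Suc k * ?l + i) \<and> vert v w (Suc k * ?l + i) \<notin> C"
      using \<open>visited_once p\<close> by (simp add: p_def)
  qed
qed

end

end

section \<open>Counting the periods of loops\<close>

context letter_action
begin

lemma edge_at_inv_word:
  assumes "\<And>i k. i \<le> k * p \<Longrightarrow> vert v (inv_word w) i = vert v w (k * p - i)"
    and "\<And>i k. i < k * p \<Longrightarrow> letter (inv_word w) i = flip (letter w (k * p - Suc i))"
    and "0 < p"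
  shows "\<exists>j. edge_at v (inv_word w) i = edge_at v w j"
proof -
  have "Suc i * 1 \<le> Suc i * p" using assms(3) by (intro mult_le_mono2) simp
  then have i: "i < Suc i * p" by simp
  define j where "j = Suc i * p - Suc i"
  have "Suc i * p - i = Suc j" using i by (simp add: j_def)
  then have "edge_at v (inv_word w) i = edge_at v w j"
    using assms(1)[of i "Suc i"] assms(2)[OF i] i unfolding edge_at_def j_def[symmetric]
    by (simp add: vert_Suc)
  then show ?thesis ..
qed

end

context coset_graph
begin

text \<open>Agreement on this many letters gives \<open>w @ w' = w' @ w\<close>; the primitive words
  then coincide, and so do their periods at \<open>v\<close>.\<close>

lemma loop_agree_period:
  assumes "loop v w n" "loop v w' n'"
    and agree: "\<And>i. i < length w + length w' \<Longrightarrow> letter w i = letter w' i"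
  shows "n = n'"
proof -
  have nth: "(u @ u') ! i = letter u i"
    if "i < length u + length u'" "\<And>i. i < length u + length u' \<Longrightarrow> letter u i = letter u' i"
    for u u' :: "('x \<times> bool) list" and i
  proof (cases "i < length u")
    case False
    then have "(u @ u') ! i = letter u' (i - length u)"
      using that(1) by (simp add: nth_append letter_less)
    also have "\<dots> = letter u (i - length u)" using that by (intro that(2)[symmetric]) simp
    also have "\<dots> = letter u i" using False letter_add_mult[of u "i - length u" 1] by simp
    finally show ?thesis .
  qed (simp add: nth_append letter_less)
  have "w @ w' = w' @ w"
  proof (rule nth_equalityI)
    fix i assume "i < length (w @ w')"
    then have i: "i < length w + length w'" by simp
    have "(w @ w') ! i = letter w i" using i agree by (intro nth)
    also have "\<dots> = letter w' i" using i by (rule agree)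
    also have "\<dots> = (w' @ w) ! i" using i agree by (intro nth[symmetric]) (simp_all add: add.commute)
    finally show "(w @ w') ! i = (w' @ w) ! i" .
  qed simp
  then have "w = w'" using assms(1,2) unfolding loop_def by (blast intro: rot_primitive_commute)
  then show ?thesis using assms(1,2) loop_period_unique by blast
qed

section \<open>The union graph of finitely many loops\<close>

context
  fixes M :: "nat set" and v :: "nat \<Rightarrow> 'v" and w :: "nat \<Rightarrow> ('x \<times> bool) list"
  assumes finite_M: "finite M" and loops: "\<And>n. n \<in> M \<Longrightarrow> loop (v n) (w n) n"
begin

definition GE :: "('v \<times> 'x) set" where
  "GE = (\<Union>n\<in>M. edge_at (v n) (w n) ` {..<n * length (w n)})"

definition GV :: "'v set" where
  "GV = (\<Union>n\<in>M. vert (v n) (w n) ` {..<n * length (w n)})"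

text \<open>The degree counts letters, that is, half-edges, so an edge from \<open>u\<close> to
  itself counts twice.\<close>

definition branch :: "'v set" where
  "branch = {u \<in> GV. 3 \<le> card {l. edge u l \<in> GE}}"

lemma position_less:
  assumes "n \<in> M"
  shows "i mod (n * length (w n)) < n * length (w n)"
  using loops[OF assms] n_pos[of "v n" "w n" n] length_pos[of "v n" "w n" n] by simp

lemma edge_at_GE: "n \<in> M \<Longrightarrow> edge_at (v n) (w n) i \<in> GE"
  unfolding GE_def using position_less edge_at_mod[OF loops]
  by (intro UN_I[of n] image_eqI[of _ _ "i mod (n * length (w n))"]) auto

lemma vert_GV: "n \<in> M \<Longrightarrow> vert (v n) (w n) i \<in> GV"
  unfolding GV_def using position_less vert_mod[OF loops]
  by (intro UN_I[of n] image_eqI[of _ _ "i mod (n * length (w n))"]) auto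

lemma finite_GE: "finite GE" and finite_GV: "finite GV"
  by (simp_all add: GE_def GV_def finite_M)

lemma card_GE_le: "card GE \<le> card GV + card Y"
proof (rule card_edges_le[OF finite_GE _ finite_GV])
  show "GE \<subseteq> V \<times> X"
    unfolding GE_def using edge_at_in[OF loops] by blast
  fix u x assume "(u, x) \<in> GE"
  then obtain n i where n: "n \<in> M" and i: "edge_at (v n) (w n) i = (u, x)"
    unfolding GE_def by (elim UN_E imageE) metis
  have ends: "u \<in> {vert (v n) (w n) i, vert (v n) (w n) (Suc i)}"
    "act u (x, True) \<in> {vert (v n) (w n) i, vert (v n) (w n) (Suc i)}"
    using edge_ends[of "vert (v n) (w n) i" "letter (w n) i" u x] i
    by (auto simp: edge_at_def vert_Suc)
  then show "u \<in> GV \<and> act u (x, True) \<in> GV" using vert_GV[OF n] by (metis insertE singletonD)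
qed

lemma finite_letters: "finite {l. edge u l \<in> GE}"
proof (rule finite_subset)
  show "{l. edge u l \<in> GE} \<subseteq> snd ` GE \<times> UNIV"
    by (auto simp: edge_def image_iff split: if_splits) (metis snd_conv)+
qed (simp add: finite_GE)

lemma two_letters:
  assumes "u \<in> GV"
  shows "2 \<le> card {l. edge u l \<in> GE}"
proof -
  obtain n i where n: "n \<in> M" and u: "u = vert (v n) (w n) i"
    using assms unfolding GV_def by (elim UN_E imageE) metis
  note L = loops[OF n]
  define p where "p = n * length (w n)"
  have "0 < p" using n_pos[OF L] length_pos[OF L] by (simp add: p_def)
  \<comment> \<open>A full turn is added so that the position has a predecessor even if
    \<open>i\<close> is 0.\<close>
  then obtain j where j: "i + p = Suc j" by (cases "i + p") auto
  have u': "u = vert (v n) (w n) (Suc j)"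
    using vert_mod[OF L, of "i + p"] vert_mod[OF L, of i] by (simp add: u j[symmetric] p_def)
  have "{letter (w n) (Suc j), flip (letter (w n) j)} \<subseteq> {l. edge u l \<in> GE}"
    using edge_at_GE[OF n, of "Suc j"] edge_at_GE[OF n, of j] by (simp add: u' edge_at_def vert_Suc)
  then have "card {letter (w n) (Suc j), flip (letter (w n) j)} \<le> card {l. edge u l \<in> GE}"
    by (intro card_mono finite_letters)
  then show ?thesis using nonbacktracking[OF L, of j] by simp
qed

text \<open>Count half-edges: there are at most \<open>2 * card GE\<close>, each vertex carries at
  least two and each branch vertex at least three. The Euler bound \<open>card_GE_le\<close> does
  the rest.\<close>

lemma card_branch_le: "card branch \<le> 2 * card Y"
proof -
  let ?H = "SIGMA u:GV. {l. edge u l \<in> GE}"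
  let ?f = "\<lambda>(e, b). if b then (fst e, (snd e, True)) else (act (fst e) (snd e, True), (snd e, False))"
  have "?H \<subseteq> ?f ` (GE \<times> UNIV)"
  proof clarify
    fix u x b assume e: "edge u (x, b) \<in> GE"
    have "?f (edge u (x, b), b) = (u, (x, b))"
      using act_flip[of u "(x, b)"] by (auto simp: edge_def flip_def)
    then show "(u, x, b) \<in> ?f ` (GE \<times> UNIV)" using e by (metis (no_types, lifting) SigmaI UNIV_I image_eqI)
  qed
  then have "card ?H \<le> card (?f ` (GE \<times> UNIV))"
    by (intro card_mono finite_imageI) (simp_all add: finite_GE)
  also have "\<dots> \<le> card (GE \<times> (UNIV :: bool set))" by (rule card_image_le) (simp add: finite_GE)
  finally have "card ?H \<le> 2 * card GE" by (simp add: card_cartesian_product)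
  moreover have "card ?H = (\<Sum>u\<in>GV. card {l. edge u l \<in> GE})"
    using finite_GV finite_letters by (intro card_SigmaI) auto
  moreover have "(\<Sum>u\<in>GV. 2 + (if u \<in> branch then 1 else 0)) \<le> (\<Sum>u\<in>GV. card {l. edge u l \<in> GE})"
  proof (rule sum_mono)
    fix u assume "u \<in> GV"
    then show "2 + (if u \<in> branch then 1 else 0) \<le> card {l. edge u l \<in> GE}"
      using two_letters[of u] by (simp add: branch_def del: One_nat_def)
  qed
  moreover have "(\<Sum>u\<in>GV. 2 + (if u \<in> branch then 1 else 0)) = 2 * card GV + card branch"
  proof -
    have "GV \<inter> branch = branch" by (auto simp: branch_def)
    then show ?thesis
      using finite_GV unfolding sum.distrib by (simp add: sum.If_cases)
  qed
  ultimately show ?thesis using card_GE_le by linarith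
qed

text \<open>At a vertex which is not a branch point, a nonbacktracking path has only one way to go on.\<close>

lemma follow:
  assumes step: "\<And>i. x (Suc i) = act (x i) (a i)" "\<And>i. x' (Suc i) = act (x' i) (a' i)"
    and nb: "\<And>i. a (Suc i) \<noteq> flip (a i)" "\<And>i. a' (Suc i) \<noteq> flip (a' i)"
    and GE: "\<And>i. edge (x i) (a i) \<in> GE" "\<And>i. edge (x' i) (a' i) \<in> GE"
    and start: "x 0 = x' 0" "a 0 = a' 0"
    and GV: "\<And>i. 0 < i \<Longrightarrow> i < L \<Longrightarrow> x i \<in> GV - branch"
  shows "i < L \<Longrightarrow> x i = x' i \<and> a i = a' i"
proof (induction i)
  case 0
  then show ?case using start by simp
next
  case (Suc i)
  then have IH: "x i = x' i" "a i = a' i" by auto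
  let ?u = "x (Suc i)"
  have u: "?u = x' (Suc i)" using IH step by simp
  have "a (Suc i) = a' (Suc i)"
  proof (rule ccontr)
    assume ne: "a (Suc i) \<noteq> a' (Suc i)"
    let ?S = "{flip (a i), a (Suc i), a' (Suc i)}"
    have "edge ?u (flip (a i)) \<in> GE" using GE(1)[of i] by (simp add: step)
    then have "?S \<subseteq> {l. edge ?u l \<in> GE}" using GE(1)[of "Suc i"] GE(2)[of "Suc i"] u by auto
    then have "card ?S \<le> card {l. edge ?u l \<in> GE}" by (intro card_mono finite_letters)
    moreover have "card ?S = 3" using ne nb(1)[of i] nb(2)[of i] IH by auto
    ultimately have "?u \<in> branch" using GV[of "Suc i"] Suc.prems by (simp add: branch_def)
    then show False using GV[of "Suc i"] Suc.prems by simp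
  qed
  then show ?case using u by simp
qed

text \<open>By \<open>follow\<close>, the other loop stays with the run for
  \<open>2 * length (w n)\<close> letters. Since its word is no longer than \<open>w n\<close>, this
  suffices for \<open>loop_agree_period\<close>.\<close>

lemma run_determines_loop:
  assumes n: "n \<in> M" and run: "\<And>i. i < 2 * length (w n) \<Longrightarrow> vert (v n) (w n) (s + i) \<notin> branch"
    and L': "loop v' w' n'" "length w' \<le> length (w n)" "\<And>i. edge_at v' w' i \<in> GE"
    and meet: "vert v' w' t = vert (v n) (w n) s" "letter w' t = letter (w n) s"
  shows "n = n'"
proof (rule loop_agree_period)
  note L = loops[OF n]
  show "loop (vert (v n) (w n) s) (rotate s (w n)) n" by (rule loop_rotate[OF L])
  show "loop (vert (v n) (w n) s) (rotate t w') n'" using loop_rotate[OF L'(1), of t] by (simp add: meet)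
  fix i assume "i < length (rotate s (w n)) + length (rotate t w')"
  then have "i < 2 * length (w n)" using L'(2) by simp
  then have "vert (v n) (w n) (s + i) = vert v' w' (t + i) \<and> letter (w n) (s + i) = letter w' (t + i)"
  proof (rule follow[rotated -1])
    show "vert (v n) (w n) (s + i) \<in> GV - branch" if "0 < i" "i < 2 * length (w n)" for i
      using run[OF that(2)] vert_GV[OF n] by simp
  qed (use nonbacktracking[OF L] nonbacktracking[OF L'(1)] edge_at_GE[OF n] L'(3) meet
      in \<open>simp_all add: vert_Suc edge_at_def\<close>)
  then show "letter (rotate s (w n)) i = letter (rotate t w') i"
    using nonempty[OF L] nonempty[OF L'(1)] by (simp add: letter_rotate)
qed

text \<open>The first edge \<open>e n\<close> of the run on loop \<open>n\<close> is crossed once by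
  that loop and missed by the others whose words are no longer. Hence distinct subsets of these
  edges have distinct images under \<open>\<Phi>\<close>, and there are at most
  \<open>2 ^ card Y\<close> images.\<close>

lemma card_long_periods:
  assumes long: "\<And>n. n \<in> M \<Longrightarrow> 10 * card Y < n"
  shows "card M \<le> card Y"
proof -
  have "finite branch" using finite_GV by (simp add: branch_def)
  then have "\<forall>n\<in>M. \<exists>s. \<forall>i < 2 * length (w n).
      visited_once (v n) (w n) n (s + i) \<and> vert (v n) (w n) (s + i) \<notin> branch"
    using ex_run[OF loops] card_branch_le long by blast
  from bchoice[OF this] obtain s where s: "\<And>n i. n \<in> M \<Longrightarrow> i < 2 * length (w n) \<Longrightarrow>
      visited_once (v n) (w n) n (s n + i) \<and> vert (v n) (w n) (s n + i) \<notin> branch"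
    by blast
  define e where "e n = edge_at (v n) (w n) (s n)" for n
  have other: "n = n'" if n: "n \<in> M" "n' \<in> M" "length (w n') \<le> length (w n)" "e n = edge_at (v n') (w n') t" for n n' t
  proof -
    note L' = loops[OF n(2)]
    have run: "i < 2 * length (w n) \<Longrightarrow> vert (v n) (w n) (s n + i) \<notin> branch" for i using s n by blast
    from n(4) show ?thesis unfolding e_def
    proof (rule edge_at_eqE)
      assume *: "vert (v n') (w n') t = vert (v n) (w n) (s n)" "letter (w n') t = letter (w n) (s n)"
      show ?thesis
        by (rule run_determines_loop[OF n(1) run L' n(3) edge_at_GE[OF n(2)] *])
    next
      assume *: "letter (w n') t = flip (letter (w n) (s n))" "vert (v n') (w n') (Suc t) = vert (v n) (w n) (s n)"
      \<comment> \<open>For a passage in the opposite direction, the other loop is replaced by its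
        inverse and \<open>t\<close> by a reflected position.\<close>
      let ?p = "n' * length (w n')" and ?w = "inv_word (w n')"
      have p: "0 < ?p" using n_pos[OF L'] length_pos[OF L'] by simp
      have V: "vert (v n') ?w i = vert (v n') (w n') (k * ?p - i)" if "i \<le> k * ?p" for i k
        using vert_inv_word[OF L', of i k] that by (simp add: mult.assoc)
      have W: "letter ?w i = flip (letter (w n') (k * ?p - Suc i))" if "i < k * ?p" for i k
        using letter_inv_word[of i "k * n'" "w n'"] that by (simp add: mult.assoc)
      have GE: "edge_at (v n') ?w i \<in> GE" for i
        using edge_at_inv_word[of ?p "v n'" "w n'" i, OF V W p] edge_at_GE[OF n(2)] by metis
      define i where "i = Suc t * ?p - Suc t"
      have "Suc t * 1 \<le> Suc t * ?p" using p by (intro mult_le_mono2) linarith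
      then have i: "i < Suc t * ?p" "Suc t * ?p - i = Suc t" "Suc t * ?p - Suc i = t" by (simp_all add: i_def)
      have "vert (v n') ?w i = vert (v n) (w n) (s n)" using V[of i "Suc t"] i *(2) by simp
      moreover have "letter ?w i = letter (w n) (s n)" using W[OF i(1)] i *(1) by simp
      ultimately show ?thesis
        using n(3) by (intro run_determines_loop[OF n(1) run loop_inv_word[OF L'] _ GE]) simp_all
    qed
  qed
  \<comment> \<open>Both ends of \<open>e n\<close> are visited once, and a second passage in
    reverse would be backtracking.\<close>
  have own: "i mod (n * length (w n)) = s n mod (n * length (w n))"
    if n: "n \<in> M" and eq: "e n = edge_at (v n) (w n) i" for n i
  proof -
    note L = loops[OF n]
    have l: "0 < length (w n)" by (rule length_pos[OF L])
    have once: "visited_once (v n) (w n) n (s n)" "visited_once (v n) (w n) n (Suc (s n))"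
      using s[OF n, of 0] s[OF n, of 1] l by simp_all
    from eq show ?thesis unfolding e_def
    proof (rule edge_at_eqE)
      assume "vert (v n) (w n) i = vert (v n) (w n) (s n)"
      then show ?thesis using once(1) visited_once_def[OF L] by blast
    next
      assume *: "vert (v n) (w n) i = vert (v n) (w n) (Suc (s n))" "letter (w n) i = flip (letter (w n) (s n))"
      then have "i mod (n * length (w n)) = Suc (s n) mod (n * length (w n))"
        using once(2) visited_once_def[OF L] by blast
      then have "letter (w n) i = letter (w n) (Suc (s n))"
        using letter_mod[OF L, of i] letter_mod[OF L, of "Suc (s n)"] by simp
      then show ?thesis using *(2) nonbacktracking[OF L, of "s n"] by simp
    qed
  qed
  have inj: "inj_on e M"
  proof (rule inj_onI)
    fix n n' assume *: "n \<in> M" "n' \<in> M" "e n = e n'"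
    show "n = n'"
    proof (cases "length (w n') \<le> length (w n)")
      case True
      then show ?thesis using other[of n n' "s n'"] * by (simp add: e_def)
    next
      case False
      then show ?thesis using other[of n' n "s n"] * by (simp add: e_def)
    qed
  qed
  have "inj_on (\<lambda>T. \<Phi> (e ` T)) (Pow M)"
  proof (rule inj_onI, rule ccontr)
    fix T T' assume T: "T \<in> Pow M" "T' \<in> Pow M" and eq: "\<Phi> (e ` T) = \<Phi> (e ` T')" and ne: "T \<noteq> T'"
    define S where "S = sym_diff T T'"
    have S: "S \<subseteq> M" "S \<noteq> {}" using T ne by (auto simp: S_def)
    have "finite S" using S(1) finite_M by (rule finite_subset)
    then obtain j where j: "j \<in> S" "\<And>k. k \<in> S \<Longrightarrow> length (w j) \<le> length (w k)"
      using S(2) ex_min_if_finite[of "(\<lambda>k. length (w k)) ` S"] by (auto simp: not_less)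
    have jM: "j \<in> M" using j S by blast
    note L = loops[OF jM]
    let ?p = "j * length (w j)"
    let ?u = "map (letter (w j)) [0..<?p]"
    have "fst ` set ?u \<subseteq> X" using letter_in[OF L] by auto
    moreover have "path (v j) ?u = v j"
      using vert_mod[OF L, of ?p] by (simp add: vert_def)
    moreover have "v j \<in> V" using L by (simp add: loop_def)
    ultimately have "par (e ` T) (v j) ?u = par (e ` T') (v j) ?u"
      using Phi_determines[OF eq] by blast
    then have "\<not> par (sym_diff (e ` T) (e ` T')) (v j) ?u" by (simp add: par_sym_diff)
    moreover have "sym_diff (e ` T) (e ` T') = e ` S"
    proof -
      have "e ` (T - T') = e ` T - e ` T'" "e ` (T' - T) = e ` T' - e ` T"
        using T by (intro inj_on_image_set_diff[OF inj]; blast)+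
      then show ?thesis unfolding S_def image_Un by simp
    qed
    moreover have "{i. i < ?p \<and> edge_at (v j) (w j) i \<in> e ` S} = {s j mod ?p}"
    proof (intro equalityI subsetI)
      fix i assume i: "i \<in> {i. i < ?p \<and> edge_at (v j) (w j) i \<in> e ` S}"
      then obtain k where k: "k \<in> S" "e k = edge_at (v j) (w j) i" by auto
      have "k = j" using other[OF _ jM j(2)[OF k(1)] k(2)] k(1) S(1) by blast
      then show "i \<in> {s j mod ?p}" using own[OF jM, of i] k i by simp
    next
      fix i assume "i \<in> {s j mod ?p}"
      then have "i < ?p" "edge_at (v j) (w j) i = e j"
        using position_less[OF jM] edge_at_mod[OF L] by (simp_all add: e_def)
      then show "i \<in> {i. i < ?p \<and> edge_at (v j) (w j) i \<in> e ` S}" using j(1) by auto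
    qed
    ultimately show False by (simp add: par_positions)
  qed
  then have "card (Pow M) \<le> card (Pow Y)"
    using Phi_subset finite_Y by (intro card_inj_on_le) auto
  then show ?thesis by (simp add: card_Pow finite_M finite_Y)
qed

end

text \<open>Finiteness comes with the bound, as \<open>card_long_periods\<close> bounds all finite
  subsets uniformly.\<close>

corollary card_long_loop_periods:
  "finite {n. 10 * card Y < n \<and> (\<exists>v w. loop v w n)} \<and> card {n. 10 * card Y < n \<and> (\<exists>v w. loop v w n)} \<le> card Y"
proof (rule finite_if_finite_subsets_card_bdd)
  fix M assume M: "M \<subseteq> {n. 10 * card Y < n \<and> (\<exists>v w. loop v w n)}" "finite M"
  then have "\<forall>n\<in>M. \<exists>p. loop (fst p) (snd p) n" by fastforce
  from bchoice[OF this] obtain p where p: "\<forall>n\<in>M. loop (fst (p n)) (snd (p n)) n" ..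
  show "card M \<le> card Y"
    by (rule card_long_periods[of M "\<lambda>n. fst (p n)" "\<lambda>n. snd (p n)"]) (use M p in blast)+
qed

end

section \<open>Bases of free groups and their subgroups\<close>

lemma word_value_Nil [simp]: "word_value G [] = \<one>\<^bsub>G\<^esub>"
  and word_value_Cons [simp]: "word_value G (l # w) = letter_value G l \<otimes>\<^bsub>G\<^esub> word_value G w"
  by (simp_all add: word_value_def)

context group
begin

lemma letter_value_closed [simp]: "fst l \<in> carrier G \<Longrightarrow> letter_value G l \<in> carrier G"
  by (simp add: letter_value_def)

lemma letter_value_flip [simp]: "fst l \<in> carrier G \<Longrightarrow> letter_value G (flip l) = inv (letter_value G l)"
  by (simp add: letter_value_def)

lemma word_value_closed [simp]: "fst ` set w \<subseteq> carrier G \<Longrightarrow> word_value G w \<in> carrier G"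
  by (induction w) auto

lemma word_value_append [simp]:
  "fst ` set u \<subseteq> carrier G \<Longrightarrow> fst ` set w \<subseteq> carrier G \<Longrightarrow>
     word_value G (u @ w) = word_value G u \<otimes> word_value G w"
  by (induction u) (auto simp: m_assoc)

lemma word_value_inv_word [simp]:
  "fst ` set w \<subseteq> carrier G \<Longrightarrow> word_value G (inv_word w) = inv (word_value G w)"
proof (induction w)
  case (Cons l w)
  then have "word_value G (inv_word w @ [flip l]) = inv (word_value G w) \<otimes> (inv (letter_value G l) \<otimes> \<one>)"
    by (subst word_value_append) (auto simp: image_subset_iff)
  then show ?case using Cons.prems by (simp add: inv_mult_group)
qed simp

lemma word_value_red [simp]:
  "fst ` set w \<subseteq> carrier G \<Longrightarrow> word_value G (red w) = word_value G w"
proof (induction w)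
  case (Cons l w)
  have w: "fst ` set (red w) \<subseteq> carrier G" "fst l \<in> carrier G" using Cons.prems set_red[of w] by auto
  show ?case
  proof (cases l "red w" rule: cancel_cons_cases)
    case (1 v)
    then have v: "fst ` set v \<subseteq> carrier G" using w by auto
    have "word_value G w = inv (letter_value G l) \<otimes> word_value G v"
      using Cons w 1(1) by simp
    then show ?thesis using 1 w v by (simp add: m_assoc[symmetric])
  next
    case 2
    then show ?thesis using Cons by simp
  qed
qed simp

lemma word_value_concat_replicate:
  "fst ` set w \<subseteq> carrier G \<Longrightarrow> word_value G (concat (replicate k w)) = word_value G w [^] k"
proof (induction k)
  case (Suc k)
  have "fst ` set (concat (replicate k w)) \<subseteq> carrier G" using Suc.prems by (induction k) auto
  then show ?case
    unfolding nat_pow_Suc2[OF word_value_closed[OF Suc.prems]] using Suc by simp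
qed simp

lemma word_value_subgroup:
  assumes "subgroup H G" "fst ` set w \<subseteq> H"
  shows "word_value (G\<lparr>carrier := H\<rparr>) w = word_value G w" "word_value G w \<in> H"
proof -
  have "word_value (G\<lparr>carrier := H\<rparr>) w = word_value G w \<and> word_value G w \<in> H"
    using assms(2)
  proof (induction w)
    case Nil
    then show ?case using assms(1) by (simp add: subgroup.one_closed)
  next
    case (Cons l w)
    have l: "fst l \<in> H" using Cons.prems by simp
    then have "letter_value (G\<lparr>carrier := H\<rparr>) l = letter_value G l" "letter_value G l \<in> H"
      using assms(1) m_inv_consistent[OF assms(1) l] by (simp_all add: letter_value_def subgroup.m_inv_closed)
    then show ?case using Cons assms(1) by (simp add: subgroup.m_closed)
  qed
  then show "word_value (G\<lparr>carrier := H\<rparr>) w = word_value G w" "word_value G w \<in> H" by auto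
qed

lemma free_basis_subset: "free_basis G X \<Longrightarrow> X \<subseteq> carrier G"
  by (simp add: free_basis_def)

lemma free_basis_word:
  assumes "free_basis G X" "g \<in> carrier G"
  shows "\<exists>w. fst ` set w \<subseteq> X \<and> reduced w \<and> word_value G w = g"
proof -
  have "g \<in> word_value G ` reduced_words X" using assms by (simp add: free_basis_def bij_betw_def)
  then obtain w where "w \<in> reduced_words X" "g = word_value G w" by blast
  then show ?thesis unfolding reduced_words_iff by blast
qed

lemma free_basis_red_eq:
  assumes X: "free_basis G X" and uw: "fst ` set u \<subseteq> X" "fst ` set w \<subseteq> X" "word_value G u = word_value G w"
  shows "red u = red w"
proof -
  have "inj_on (word_value G) (reduced_words X)" using X by (simp add: free_basis_def bij_betw_def)
  moreover have "red u \<in> reduced_words X" "red w \<in> reduced_words X"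
    using uw set_red[of u] set_red[of w] by (simp_all add: reduced_words_iff)
  moreover have "word_value G (red u) = word_value G (red w)"
    using uw free_basis_subset[OF X] by (subst (1 2) word_value_red) auto
  ultimately show ?thesis by (meson inj_onD)
qed

text \<open>Finitely many generators involve only a finite part \<open>X0\<close> of the basis. Any
  other basis element would be a word over \<open>X0\<close>, against uniqueness of reduced
  words.\<close>

lemma finite_free_basis:
  assumes X: "free_basis G X" and S: "finite S" "S \<subseteq> carrier G" "generate G S = carrier G"
  shows "finite X"
proof -
  have "\<forall>s\<in>S. \<exists>w. fst ` set w \<subseteq> X \<and> reduced w \<and> word_value G w = s"
    using free_basis_word[OF X] S(2) by blast
  from bchoice[OF this] obtain f where f: "\<And>s. s \<in> S \<Longrightarrow> fst ` set (f s) \<subseteq> X \<and> word_value G (f s) = s"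
    by blast
  define X0 where "X0 = (\<Union>s\<in>S. fst ` set (f s))"
  have X0: "finite X0" "X0 \<subseteq> X" "X0 \<subseteq> carrier G"
    using f S(1) free_basis_subset[OF X] by (auto simp: X0_def)
  define K where "K = word_value G ` {w. fst ` set w \<subseteq> X0}"
  have "subgroup K G"
  proof
    show "K \<subseteq> carrier G" using X0(3) by (auto simp: K_def)
    show "\<one> \<in> K" unfolding K_def by (rule image_eqI[of _ _ "[]"]) auto
  next
    fix x y assume "x \<in> K" "y \<in> K"
    then obtain u w where uw: "fst ` set u \<subseteq> X0" "fst ` set w \<subseteq> X0" "x = word_value G u" "y = word_value G w"
      by (auto simp: K_def)
    then show "x \<otimes> y \<in> K" unfolding K_def using X0(3)
      by (intro image_eqI[of _ _ "u @ w"]) (simp_all add: image_Un)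
  next
    fix x assume "x \<in> K"
    then obtain u where u: "fst ` set u \<subseteq> X0" "x = word_value G u" by (auto simp: K_def)
    then show "inv x \<in> K" unfolding K_def using X0(3)
      by (intro image_eqI[of _ _ "inv_word u"]) simp_all
  qed
  moreover have "S \<subseteq> K"
  proof
    fix s assume "s \<in> S"
    then show "s \<in> K" unfolding K_def using f by (intro image_eqI[of _ _ "f s"]) (auto simp: X0_def)
  qed
  ultimately have K: "carrier G \<subseteq> K" using generate_subgroup_incl[of S K] S(3) by simp
  have "x \<in> X0" if x: "x \<in> X" for x
  proof -
    have xc: "x \<in> carrier G" using x free_basis_subset[OF X] by blast
    then obtain w where w: "fst ` set w \<subseteq> X0" "x = word_value G w" using K by (auto simp: K_def)
    have "red [(x, True)] = red w"
      by (rule free_basis_red_eq[OF X]) (use x xc w X0(2) in \<open>auto simp: letter_value_def\<close>)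
    then have "fst ` set [(x, True)] \<subseteq> fst ` set w"
      using set_red[of w] by (simp add: cancel_cons_def)
    then show ?thesis using w(1) by auto
  qed
  then show ?thesis using X0(1) by (meson finite_subset subsetI)
qed

end

section \<open>The Schreier graph of the right cosets of \<open>A\<close>\<close>

locale free_subgroup = group F for F :: "('a, 'b) monoid_scheme" (structure) +
  fixes X A :: "'a set"
  assumes basis: "free_basis F X" and subgroup_A: "subgroup A F"
begin

text \<open>Right multiplication, extended by the identity outside the cosets and the basis so that
  \<open>act_flip\<close> holds for all arguments.\<close>

definition coset_act :: "'a set \<Rightarrow> 'a \<times> bool \<Rightarrow> 'a set" where
  "coset_act U l = (if U \<in> rcosets A \<and> fst l \<in> X then U #> letter_value F l else U)"

lemma X_carrier [simp]: "x \<in> X \<Longrightarrow> x \<in> carrier F"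
  using free_basis_subset[OF basis] by blast

lemma word_carrier [simp]: "fst ` set w \<subseteq> X \<Longrightarrow> fst ` set w \<subseteq> carrier F"
  using free_basis_subset[OF basis] by blast

lemma A_carrier: "A \<subseteq> carrier F"
  using subgroup_A by (rule subgroup.subset)

lemma coset_carrier: "U \<in> rcosets A \<Longrightarrow> U \<subseteq> carrier F"
  using rcosets_part_G[OF subgroup_A] by blast

lemma coset_r_coset:
  assumes "U \<in> rcosets A" "g \<in> carrier F"
  shows "U #> g \<in> rcosets A"
proof -
  obtain h where "h \<in> carrier F" "U = A #> h" using assms(1) by (auto simp: RCOSETS_def)
  then show ?thesis using assms(2) A_carrier by (auto simp: RCOSETS_def coset_mult_assoc)
qed

lemma A_coset [simp]: "A \<in> rcosets A"
  unfolding RCOSETS_def using coset_mult_one[OF A_carrier] by force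

sublocale letter_action coset_act
proof
  fix U l
  show "coset_act (coset_act U l) (flip l) = U"
  proof (cases "U \<in> rcosets A \<and> fst l \<in> X")
    case True
    then have "U #> letter_value F l #> inv (letter_value F l) = U"
      using coset_carrier by (simp add: coset_mult_assoc)
    then show ?thesis using True by (simp add: coset_act_def coset_r_coset)
  qed (auto simp: coset_act_def)
qed

lemma act_in [simp]: "U \<in> rcosets A \<Longrightarrow> coset_act U l \<in> rcosets A"
  by (simp add: coset_act_def coset_r_coset)

lemma path_in [simp]: "U \<in> rcosets A \<Longrightarrow> path U w \<in> rcosets A"
  by (induction w arbitrary: U) auto

lemma path_eq: "U \<in> rcosets A \<Longrightarrow> fst ` set w \<subseteq> X \<Longrightarrow> path U w = U #> word_value F w"
proof (induction w arbitrary: U)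
  case Nil
  then show ?case using coset_carrier by simp
next
  case (Cons l w)
  have "fst ` set w \<subseteq> X" "fst l \<in> X" using Cons.prems by auto
  then show ?case
    using Cons.IH[of "coset_act U l"] Cons.prems(1) coset_carrier
    by (simp add: coset_act_def coset_r_coset coset_mult_assoc)
qed

lemma path_A_iff: "fst ` set w \<subseteq> X \<Longrightarrow> path A w = A \<longleftrightarrow> word_value F w \<in> A"
  using coset_join1[OF _ _ subgroup_A, of "word_value F w"] coset_join2[OF _ subgroup_A, of "word_value F w"]
  by (auto simp: path_eq)

lemma word_exists: "g \<in> carrier F \<Longrightarrow> \<exists>w. fst ` set w \<subseteq> X \<and> reduced w \<and> word_value F w = g"
  by (rule free_basis_word[OF basis])

lemma connected_A:
  assumes "U \<in> rcosets A"
  shows "\<exists>w. fst ` set w \<subseteq> X \<and> path A w = U"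
proof -
  obtain h where h: "h \<in> carrier F" "U = A #> h" using assms by (auto simp: RCOSETS_def)
  obtain w where w: "fst ` set w \<subseteq> X" "word_value F w = h" using word_exists[OF h(1)] by blast
  then have "path A w = U" using path_eq[OF A_coset] h(2) by simp
  then show ?thesis using w(1) by blast
qed

primrec expand :: "('c \<Rightarrow> ('a \<times> bool) list) \<Rightarrow> ('c \<times> bool) list \<Rightarrow> ('a \<times> bool) list" where
  "expand E [] = []"
| "expand E (l # v) = (if snd l then E (fst l) else inv_word (E (fst l))) @ expand E v"

lemma expand_properties:
  assumes E: "\<And>y. y \<in> Y \<Longrightarrow> fst ` set (E y) \<subseteq> X \<and> word_value F (E y) = y" and Y: "Y \<subseteq> A"
    and v: "fst ` set v \<subseteq> Y"
  shows "fst ` set (expand E v) \<subseteq> X \<and> word_value F (expand E v) = word_value F v \<and> path A (expand E v) = A"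
  using v
proof (induction v)
  case (Cons l v)
  let ?e = "if snd l then E (fst l) else inv_word (E (fst l))"
  have l: "fst l \<in> Y" "fst l \<in> A" "fst ` set v \<subseteq> Y" using Cons.prems Y by auto
  note IH = Cons.IH[OF l(3)]
  have e: "fst ` set ?e \<subseteq> X" "word_value F ?e = letter_value F l"
    using E[OF l(1)] by (simp_all add: letter_value_def)
  have "letter_value F l \<in> A"
    using l(2) subgroup_A by (simp add: letter_value_def subgroup.m_inv_closed)
  then have "path A ?e = A" using e path_A_iff by simp
  then show ?case using IH e by (auto simp: image_Un)
qed simp

section \<open>Schreier transversal, rewriting and the Nielsen-Schreier theorem\<close>

definition depth :: "'a set \<Rightarrow> nat" where
  "depth U = (LEAST n. \<exists>w. fst ` set w \<subseteq> X \<and> length w = n \<and> path A w = U)"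

lemma depth_le: "fst ` set w \<subseteq> X \<Longrightarrow> depth (path A w) \<le> length w"
  unfolding depth_def by (rule Least_le) blast

lemma depth_word:
  assumes "U \<in> rcosets A"
  shows "\<exists>w. fst ` set w \<subseteq> X \<and> length w = depth U \<and> path A w = U"
  unfolding depth_def by (rule LeastI_ex) (use connected_A[OF assms] in blast)

lemma depth_step:
  assumes "U \<in> rcosets A" "depth U = Suc n"
  shows "\<exists>p. fst p \<in> rcosets A \<and> fst (snd p) \<in> X \<and> coset_act (fst p) (snd p) = U \<and> depth (fst p) = n"
proof -
  obtain w where w: "fst ` set w \<subseteq> X" "length w = Suc n" "path A w = U"
    using depth_word[OF assms(1)] assms(2) by auto
  then obtain u l where u: "w = u @ [l]" by (cases w rule: rev_cases) auto
  have "depth (path A u) \<le> n" using depth_le[of u] w u by auto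
  moreover have "n \<le> depth (path A u)"
  proof -
    obtain u' where u': "fst ` set u' \<subseteq> X" "length u' = depth (path A u)" "path A u' = path A u"
      using depth_word[of "path A u"] by auto
    then have "path A (u' @ [l]) = U" using w(3) u by simp
    then show ?thesis using depth_le[of "u' @ [l]"] u' w(1) u assms(2) by (simp add: image_Un)
  qed
  ultimately show ?thesis using w u by (intro exI[of _ "(path A u, l)"]) auto
qed

text \<open>One parent is fixed for each coset of positive depth, which gives a spanning tree of
  shortest paths. At depth 0 the value is arbitrary; \<open>rep\<close> stops before consulting
  it.\<close>

definition pred :: "'a set \<Rightarrow> 'a set \<times> ('a \<times> bool)" where
  "pred U = (SOME p. fst p \<in> rcosets A \<and> fst (snd p) \<in> X \<and> coset_act (fst p) (snd p) = U \<and>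
     Suc (depth (fst p)) = depth U)"

primrec rep_upto :: "nat \<Rightarrow> 'a set \<Rightarrow> ('a \<times> bool) list" where
  "rep_upto 0 U = []"
| "rep_upto (Suc n) U = rep_upto n (fst (pred U)) @ [snd (pred U)]"

definition rep :: "'a set \<Rightarrow> ('a \<times> bool) list" where
  "rep U = rep_upto (depth U) U"

text \<open>Induction along the spanning tree. It expresses the Schreier property that
  representatives are closed under prefixes.\<close>

lemma rep_induct [consumes 1, case_names base step]:
  assumes "U \<in> rcosets A" and base: "P A []"
    and step: "\<And>U l. U \<in> rcosets A \<Longrightarrow> fst l \<in> X \<Longrightarrow> rep (coset_act U l) = rep U @ [l] \<Longrightarrow> P U (rep U) \<Longrightarrow>
      P (coset_act U l) (rep U @ [l])"
  shows "P U (rep U)"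
  using assms(1)
proof (induction "depth U" arbitrary: U)
  case 0
  then obtain w where "length w = 0" "path A w = U" using depth_word[of U] by auto
  then have "U = A" by simp
  moreover have "rep U = []" using 0(1)[symmetric] by (simp add: rep_def)
  ultimately show ?case using base by metis
next
  case (Suc n)
  have "\<exists>p. fst p \<in> rcosets A \<and> fst (snd p) \<in> X \<and> coset_act (fst p) (snd p) = U \<and>
     Suc (depth (fst p)) = depth U"
    using depth_step[OF Suc.prems Suc.hyps(2)[symmetric]] Suc.hyps(2) by auto
  then have p: "fst (pred U) \<in> rcosets A" "fst (snd (pred U)) \<in> X" "coset_act (fst (pred U)) (snd (pred U)) = U"
    "Suc (depth (fst (pred U))) = depth U"
    unfolding pred_def by (rule someI2_ex; blast)+
  have r: "rep U = rep (fst (pred U)) @ [snd (pred U)]"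
    unfolding rep_def p(4)[symmetric] by simp
  have "P (fst (pred U)) (rep (fst (pred U)))"
    using Suc.hyps(1)[of "fst (pred U)"] Suc.hyps(2) p by simp
  then show ?case using step[of "fst (pred U)" "snd (pred U)"] p(1-3) r by simp
qed

lemma rep_word: "U \<in> rcosets A \<Longrightarrow> fst ` set (rep U) \<subseteq> X \<and> path A (rep U) = U"
  by (induction U rule: rep_induct) auto

lemma rep_A: "rep A = []"
proof -
  have "depth A \<le> 0" using depth_le[of "[]"] by simp
  then show ?thesis by (simp add: rep_def)
qed

text \<open>The Schreier generator of an edge: out along the tree, across the edge, back along the
  tree.\<close>

definition edge_value :: "'a set \<times> 'a \<Rightarrow> 'a" where
  "edge_value e = word_value F (rep (fst e)) \<otimes> snd e \<otimes>
     inv (word_value F (rep (coset_act (fst e) (snd e, True))))"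

text \<open>The edges of the Schreier spanning tree have value \<open>\<one>\<close>, so only the other ones are recorded.\<close>

primrec rewrite :: "'a set \<Rightarrow> ('a \<times> bool) list \<Rightarrow> ('a \<times> bool) list" where
  "rewrite U [] = []"
| "rewrite U (l # w) =
     (if edge_value (edge U l) = \<one> then [] else [(edge_value (edge U l), snd l)]) @ rewrite (coset_act U l) w"

definition schreier_basis :: "'a set" where
  "schreier_basis = edge_value ` ((rcosets A) \<times> X) - {\<one>}"

lemma rewrite_append: "rewrite U (u @ w) = rewrite U u @ rewrite (path U u) w"
  by (induction u arbitrary: U) auto

lemma rewrite_inv_word: "rewrite (path U w) (inv_word w) = inv_word (rewrite U w)"
  by (induction w arbitrary: U) (simp_all add: rewrite_append flip_def[of "(_, _)"])

text \<open>A cancelling pair crosses one edge back and forth, so its rewritten letters cancel or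
  are both absent. Rewriting thus descends to group elements.\<close>

lemma red_rewrite_red: "red (rewrite U (red w)) = red (rewrite U w)"
proof (rule red_invariant)
  fix u l w
  let ?V = "path U u"
  show "red (rewrite U (u @ l # flip l # w)) = red (rewrite U (u @ w))"
    using red_cancel[of "rewrite U u" "(edge_value (edge ?V l), snd l)" "rewrite ?V w"]
    by (simp add: rewrite_append flip_def[of "(_, _)"])
qed

lemma edge_value_letter:
  assumes U: "U \<in> rcosets A" and l: "fst l \<in> X"
  shows "letter_value F (edge_value (edge U l), snd l) =
    word_value F (rep U) \<otimes> letter_value F l \<otimes> inv (word_value F (rep (coset_act U l)))"
proof -
  let ?r = "word_value F (rep U)" and ?r' = "word_value F (rep (coset_act U l))"
  have c: "?r \<in> carrier F" "?r' \<in> carrier F" "fst l \<in> carrier F"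
    using rep_word[OF U] rep_word[OF act_in[OF U, of l]] l by simp_all
  show ?thesis
  proof (cases "snd l")
    case True
    then have "l = (fst l, True)" by (simp add: prod_eq_iff)
    then show ?thesis
      by (metis edge_def edge_value_def fst_conv letter_value_def snd_conv)
  next
    case False
    then have "(fst l, True) = flip l" by (simp add: flip_def)
    then show ?thesis using False c
      by (simp add: edge_def edge_value_def letter_value_def inv_mult_group m_assoc)
  qed
qed

lemma edge_value_carrier:
  assumes "U \<in> rcosets A" "x \<in> X"
  shows "edge_value (U, x) \<in> carrier F"
  using rep_word[OF assms(1)] rep_word[OF act_in[OF assms(1)]] assms(2) by (simp add: edge_value_def)

lemma edge_in: "U \<in> rcosets A \<Longrightarrow> fst l \<in> X \<Longrightarrow> edge U l \<in> (rcosets A) \<times> X"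
  by (auto simp: edge_def)

lemma rewrite_letters: "U \<in> rcosets A \<Longrightarrow> fst ` set w \<subseteq> X \<Longrightarrow> fst ` set (rewrite U w) \<subseteq> schreier_basis"
proof (induction w arbitrary: U)
  case (Cons l w)
  then have "edge_value (edge U l) \<in> edge_value ` ((rcosets A) \<times> X)"
    by (intro imageI edge_in) auto
  then show ?case using Cons by (auto simp: schreier_basis_def)
qed simp

lemma schreier_basis_carrier: "schreier_basis \<subseteq> carrier F"
  using edge_value_carrier by (auto simp: schreier_basis_def)

text \<open>The product telescopes: the representatives at intermediate cosets cancel.\<close>

lemma rewrite_value:
  "U \<in> rcosets A \<Longrightarrow> fst ` set w \<subseteq> X \<Longrightarrow>
     word_value F (rewrite U w) = word_value F (rep U) \<otimes> word_value F w \<otimes> inv (word_value F (rep (path U w)))"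
proof (induction w arbitrary: U)
  case Nil
  then show ?case using rep_word[OF Nil(1)] by simp
next
  case (Cons l w)
  have l: "fst l \<in> X" and w: "fst ` set w \<subseteq> X" using Cons.prems by auto
  let ?U = "coset_act U l" and ?y = "edge_value (edge U l)"
  let ?r = "word_value F (rep U)" and ?r' = "word_value F (rep ?U)" and ?r'' = "word_value F (rep (path ?U w))"
  note U = Cons.prems(1)
  have c: "?r \<in> carrier F" "?r' \<in> carrier F" "?r'' \<in> carrier F" "fst l \<in> carrier F" "letter_value F l \<in> carrier F"
    "word_value F w \<in> carrier F"
    using rep_word[OF U] rep_word[OF act_in[OF U, of l]] rep_word[OF path_in[OF act_in[OF U, of l], of w]] l w by simp_all
  have "word_value F (rewrite U (l # w)) = letter_value F (?y, snd l) \<otimes> word_value F (rewrite ?U w)"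
    using Cons.IH[OF act_in[OF U] w] c by (auto simp: letter_value_def)
  also have "\<dots> = (?r \<otimes> letter_value F l \<otimes> inv ?r') \<otimes> (?r' \<otimes> word_value F w \<otimes> inv ?r'')"
    using Cons.IH[OF act_in[OF U] w] edge_value_letter[OF U l] by simp
  also have "\<dots> = ?r \<otimes> (letter_value F l \<otimes> word_value F w) \<otimes> inv ?r''"
    using c by (simp add: m_assoc inv_solve_left')
  finally show ?case by simp
qed

text \<open>Along the tree the new representative is the old one followed by the letter, so each
  edge has value \<open>\<one>\<close>.\<close>

lemma rewrite_rep: "U \<in> rcosets A \<Longrightarrow> rewrite A (rep U) = []"
proof (induction U rule: rep_induct)
  case (step U l)
  let ?y = "edge_value (edge U l)"
  have rU: "fst ` set (rep U) \<subseteq> X" "path A (rep U) = U" using rep_word[OF step(1)] by auto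
  have c: "word_value F (rep U) \<in> carrier F" "letter_value F l \<in> carrier F"
    using rU step(2) by simp_all
  have "word_value F (rep (coset_act U l)) = word_value F (rep U) \<otimes> letter_value F l"
    using rU step(2,3) by simp
  then have "letter_value F (?y, snd l) = \<one>"
    using edge_value_letter[OF step(1,2)] c by simp
  moreover have "?y \<in> carrier F" using edge_in[OF step(1,2)] edge_value_carrier by (metis SigmaE)
  ultimately have "?y = \<one>" by (auto simp: letter_value_def split: if_splits)
  then show ?case using step(4) rU by (simp add: rewrite_append)
qed simp

text \<open>Out along the tree, across the edge and back: the tree parts rewrite to nothing, which
  leaves the letter of the crossed edge.\<close>

lemma schreier_basis_word:
  assumes "y \<in> schreier_basis"
  shows "\<exists>w. fst ` set w \<subseteq> X \<and> word_value F w = y \<and> path A w = A \<and> rewrite A w = [(y, True)]"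
proof -
  obtain U x where U: "U \<in> rcosets A" and x: "x \<in> X" and y: "y = edge_value (U, x)" "y \<noteq> \<one>"
    using assms by (auto simp: schreier_basis_def)
  let ?U = "coset_act U (x, True)"
  let ?w = "rep U @ (x, True) # inv_word (rep ?U)"
  have U': "?U \<in> rcosets A" using U by simp
  note r = rep_word[OF U] and r' = rep_word[OF U']
  have closing: "path ?U (inv_word (rep ?U)) = A" using path_inv_word[of A "rep ?U"] r' by simp
  have X: "fst ` set ?w \<subseteq> X" using r r' x by (simp add: image_Un)
  have path: "path A ?w = A" using r closing by simp
  have "rewrite ?U (inv_word (rep ?U)) = []"
    using rewrite_inv_word[of A "rep ?U"] r' rewrite_rep[OF U'] by simp
  then have rw: "rewrite A ?w = [(y, True)]"
    using rewrite_rep[OF U] r y by (simp add: rewrite_append edge_def)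
  have wc: "word_value F ?w \<in> carrier F" by (rule word_value_closed[OF word_carrier[OF X]])
  have "word_value F (rewrite A ?w) = word_value F ?w"
    unfolding rewrite_value[OF A_coset X] path rep_A word_value_Nil inv_one l_one[OF wc] r_one[OF wc] ..
  moreover have "word_value F [(y, True)] = y"
    using edge_value_carrier[OF U x] y(1) by (simp add: letter_value_def)
  ultimately have "word_value F ?w = y" unfolding rw by simp
  then show ?thesis using X path rw by blast
qed

text \<open>Rewriting inverts \<open>expand\<close> letter by letter and respects free reduction
  over \<open>X\<close>, which gives injectivity. Surjectivity is \<open>rewrite_value\<close> on
  closed paths at \<open>A\<close>, where both representatives are empty.\<close>

theorem free_basis_schreier_basis: "free_basis (F\<lparr>carrier := A\<rparr>) schreier_basis"
proof -
  let ?Y = schreier_basis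
  have "\<forall>y\<in>?Y. \<exists>w. fst ` set w \<subseteq> X \<and> word_value F w = y \<and> path A w = A \<and> rewrite A w = [(y, True)]"
    using schreier_basis_word by blast
  from bchoice[OF this] obtain E where E: "\<And>y. y \<in> ?Y \<Longrightarrow> fst ` set (E y) \<subseteq> X \<and> word_value F (E y) = y \<and>
      path A (E y) = A \<and> rewrite A (E y) = [(y, True)]" by blast
  have YA: "?Y \<subseteq> A"
  proof
    fix y assume "y \<in> ?Y"
    then show "y \<in> A" using E[of y] path_A_iff[of "E y"] by simp
  qed
  have expand: "fst ` set (expand E v) \<subseteq> X" "word_value F (expand E v) = word_value F v"
    if "fst ` set v \<subseteq> ?Y" for v
    using expand_properties[of ?Y E, OF _ YA that] E by blast+
  have rw: "rewrite A (expand E v) = v" if "fst ` set v \<subseteq> ?Y" for v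
    using that
  proof (induction v)
    case (Cons l v)
    have l: "fst l \<in> ?Y" and v: "fst ` set v \<subseteq> ?Y" using Cons.prems by auto
    have "path A (inv_word (E (fst l))) = A" "rewrite A (inv_word (E (fst l))) = [(fst l, False)]"
      using path_inv_word[of A "E (fst l)"] rewrite_inv_word[of A "E (fst l)"] E[OF l] by (simp_all add: flip_def)
    then show ?case using E[OF l] Cons.IH[OF v] by (auto simp: rewrite_append prod_eq_iff)
  qed simp
  have inj: "inj_on (word_value F) (reduced_words ?Y)"
  proof (rule inj_onI)
    fix u v assume uv: "u \<in> reduced_words ?Y" "v \<in> reduced_words ?Y" "word_value F u = word_value F v"
    then have Y: "fst ` set u \<subseteq> ?Y" "fst ` set v \<subseteq> ?Y" by (simp_all add: reduced_words_iff)
    have "red (expand E u) = red (expand E v)"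
      using expand[OF Y(1)] expand[OF Y(2)] uv(3) by (intro free_basis_red_eq[OF basis]) simp_all
    then have "red (rewrite A (expand E u)) = red (rewrite A (expand E v))"
      unfolding red_rewrite_red[of A "expand E u", symmetric] red_rewrite_red[of A "expand E v", symmetric]
      by (rule arg_cong)
    then show "u = v" using uv Y by (simp add: rw reduced_words_iff red_eq_self)
  qed
  have "word_value F ` reduced_words ?Y = A"
  proof (intro equalityI subsetI)
    fix a assume "a \<in> word_value F ` reduced_words ?Y"
    then show "a \<in> A" using word_value_subgroup(2)[OF subgroup_A] YA by (auto simp: reduced_words_iff)
  next
    fix a assume a: "a \<in> A"
    then have "a \<in> carrier F" using A_carrier by blast
    then obtain w where w: "fst ` set w \<subseteq> X" "word_value F w = a" using word_exists by blast
    let ?v = "rewrite A w"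
    have Y: "fst ` set ?v \<subseteq> ?Y" using rewrite_letters[OF A_coset w(1)] .
    have "path A w = A" using path_A_iff[OF w(1)] w(2) a by simp
    then have "word_value F ?v = a"
      using rewrite_value[OF A_coset w(1)] w \<open>a \<in> carrier F\<close> by (simp add: rep_A)
    then have "word_value F (red ?v) = a" using Y schreier_basis_carrier by (subst word_value_red) auto
    moreover have "red ?v \<in> reduced_words ?Y" using Y set_red[of ?v] by (simp add: reduced_words_iff)
    ultimately show "a \<in> word_value F ` reduced_words ?Y" by blast
  qed
  then have "bij_betw (word_value F) (reduced_words ?Y) A" using inj by (simp add: bij_betw_def)
  moreover have "word_value (F\<lparr>carrier := A\<rparr>) v = word_value F v" if "v \<in> reduced_words ?Y" for v
    using that YA by (intro word_value_subgroup(1)[OF subgroup_A]) (auto simp: reduced_words_iff)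
  ultimately have "bij_betw (word_value (F\<lparr>carrier := A\<rparr>)) (reduced_words ?Y) A"
    by (simp cong: bij_betw_cong)
  then show ?thesis using YA by (simp add: free_basis_def)
qed

end

context free_subgroup
begin

text \<open>\<open>\<Phi> D\<close> records the parities of \<open>D\<close> along words for the
  basis elements. Up to free reduction a closed path at \<open>A\<close> is a product of these words
  and their inverses, so the recorded parities determine its own.\<close>

lemma coset_graph_exists:
  assumes Y: "free_basis (F\<lparr>carrier := A\<rparr>) Y" "finite Y"
  shows "\<exists>\<Phi>. coset_graph coset_act (rcosets A) X A Y \<Phi>"
proof -
  interpret H: group "F\<lparr>carrier := A\<rparr>" by (rule subgroup_imp_group[OF subgroup_A])
  have YA: "Y \<subseteq> A" using H.free_basis_subset[OF Y(1)] by simp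
  have "\<forall>y\<in>Y. \<exists>w. fst ` set w \<subseteq> X \<and> word_value F w = y"
    using word_exists YA A_carrier by blast
  from bchoice[OF this] obtain E where E: "\<And>y. y \<in> Y \<Longrightarrow> fst ` set (E y) \<subseteq> X \<and> word_value F (E y) = y"
    by blast
  define \<Phi> where "\<Phi> D = {y \<in> Y. par D A (E y)}" for D
  have par_expand: "par D A (expand E u) = par D' A (expand E u)"
    if eq: "\<Phi> D = \<Phi> D'" and u: "fst ` set u \<subseteq> Y" for D D' u
    using u
  proof (induction u)
    case (Cons l u)
    have l: "fst l \<in> Y" and u: "fst ` set u \<subseteq> Y" using Cons.prems by auto
    have "path A (E (fst l)) = A" using E[OF l] path_A_iff[of "E (fst l)"] l YA by auto
    then have "path A (inv_word (E (fst l))) = A" "par C A (inv_word (E (fst l))) = par C A (E (fst l))" for C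
      using path_inv_word[of A "E (fst l)"] par_inv_word[of C A "E (fst l)"] by simp_all
    moreover have "par D A (E (fst l)) = par D' A (E (fst l))" using eq l by (auto simp: \<Phi>_def)
    ultimately show ?case using Cons.IH[OF u] \<open>path A (E (fst l)) = A\<close> by simp
  qed simp
  have "coset_graph coset_act (rcosets A) X A Y \<Phi>"
  proof unfold_locales
    fix D D' U w
    assume eq: "\<Phi> D = \<Phi> D'" and U: "U \<in> rcosets A" and w: "fst ` set w \<subseteq> X" "path U w = U"
    obtain p where p: "fst ` set p \<subseteq> X" "path A p = U" using connected_A[OF U] by blast
    \<comment> \<open>The base point is moved to \<open>A\<close>; \<open>p\<close> is traversed
      twice and drops out modulo 2.\<close>
    let ?w = "p @ w @ inv_word p"
    have X: "fst ` set ?w \<subseteq> X" using p w by (simp add: image_Un)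
    have p': "path U (inv_word p) = A" "par C U (inv_word p) = par C A p" for C
      using path_inv_word[of A p] par_inv_word[of C A p] p by simp_all
    have "path A ?w = A" using p w p' by simp
    then have "word_value F ?w \<in> A" using path_A_iff[OF X] by simp
    then obtain u where u: "fst ` set u \<subseteq> Y" "word_value (F\<lparr>carrier := A\<rparr>) u = word_value F ?w"
      using H.free_basis_word[OF Y(1)] by force
    then have uA: "word_value F u = word_value F ?w"
      using word_value_subgroup(1)[OF subgroup_A, of u] YA by auto
    have ex: "fst ` set (expand E u) \<subseteq> X" "word_value F (expand E u) = word_value F u"
      using expand_properties[OF E YA u(1)] by blast+
    have "red ?w = red (expand E u)"
      using ex uA X by (intro free_basis_red_eq[OF basis]) simp_all
    then have "par C A ?w = par C A (expand E u)" for C by (metis par_red)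
    then have "par D A ?w = par D' A ?w" using par_expand[OF eq u(1)] by simp
    then show "par D U w = par D' U w" using p w p' by auto
  qed (use connected_A Y(2) in \<open>auto simp: \<Phi>_def\<close>)
  then show ?thesis by (rule exI[where P = "\<lambda>\<Phi>. coset_graph coset_act (rcosets A) X A Y \<Phi>"])
qed

lemma power_in_A_iff:
  assumes "fst ` set h \<subseteq> X" "fst ` set c \<subseteq> X"
  shows "word_value F (h @ c @ inv_word h) [^] (k :: nat) \<in> A \<longleftrightarrow>
    path (path A h) (concat (replicate k c)) = path A h"
proof -
  let ?g = "word_value F h" and ?c = "word_value F c"
  have car: "?g \<in> carrier F" "?c \<in> carrier F" using assms by simp_all
  define d where "d = concat (replicate k c)"
  have C: "fst ` set d \<subseteq> X" unfolding d_def using assms(2) by (induction k) auto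
  have d: "word_value F d = ?c [^] k" unfolding d_def using assms(2) by (simp add: word_value_concat_replicate)
  have "(?g \<otimes> (?c \<otimes> inv ?g)) [^] k = ?g \<otimes> (?c [^] k \<otimes> inv ?g)"
  proof (induction k)
    case (Suc k)
    then show ?case using car by (simp add: m_assoc inv_solve_left')
  qed (use car in simp)
  then have "word_value F (h @ c @ inv_word h) [^] k = word_value F (h @ d @ inv_word h)"
    using assms C d by (simp add: image_Un)
  moreover have "fst ` set (h @ d @ inv_word h) \<subseteq> X"
    using assms(1) C by (simp add: image_Un)
  ultimately have "word_value F (h @ c @ inv_word h) [^] k \<in> A \<longleftrightarrow>
      path A (h @ d @ inv_word h) = A"
    using path_A_iff[of "h @ d @ inv_word h"] by (simp only:)
  also have "\<dots> \<longleftrightarrow> path (path (path A h) d) (inv_word h) = path (path A h) (inv_word h)"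
    by simp
  finally show ?thesis by (simp only: path_inject d_def)
qed

end

text \<open>\<open>reduced (c @ c)\<close> encodes cyclic reducedness. As long as it fails, the
  first and last letters are inverse and are peeled off into \<open>h\<close>.\<close>

lemma cyclically_reduced_conjugate:
  "reduced w \<Longrightarrow> \<exists>h c. w = h @ c @ inv_word h \<and> reduced (c @ c)"
proof (induction "length w" arbitrary: w rule: less_induct)
  case less
  show ?case
  proof (cases "reduced (w @ w)")
    case True
    then show ?thesis by (intro exI[of _ "[]"] exI[of _ w]) simp
  next
    case False
    then have w: "w \<noteq> []" "hd w = flip (last w)"
      using less.prems by (auto simp: successively_append_iff)
    then obtain l v where lv: "w = l # v" by (cases w) auto
    have "v \<noteq> []" using w lv by auto
    then obtain u m where u: "v = u @ [m]" by (cases v rule: rev_cases) auto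
    have wu: "w = l # u @ [flip l]" using w(2) lv u by simp
    have "reduced u" using less.prems unfolding wu by (auto simp: successively_Cons successively_append_iff)
    then obtain h c where "u = h @ c @ inv_word h" "reduced (c @ c)"
      using less.hyps[of u] wu by auto
    then show ?thesis using wu by (intro exI[of _ "l # h"] exI[of _ c]) simp
  qed
qed

text \<open>Division with remainder: the power with the remainder as exponent lies in
  \<open>A\<close>, so minimality forces the remainder to be 0.\<close>

lemma (in group) ex_power_dvd:
  assumes "subgroup A G" "g \<in> carrier G" and n: "1 \<le> n" "g [^] (n :: nat) \<in> A"
  shows "relative_order G A g dvd n" "1 \<le> relative_order G A g" "g [^] relative_order G A g \<in> A"
proof -
  let ?m = "relative_order G A g"
  have m: "1 \<le> ?m \<and> g [^] ?m \<in> A"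
    unfolding relative_order_def by (rule LeastI[of _ n]) (use n in simp)
  then show "1 \<le> ?m" "g [^] ?m \<in> A" by auto
  interpret A: subgroup A G by fact
  have A: "(g [^] ?m) [^] (k :: nat) \<in> A" for k
    by (induction k) (use m in auto)
  show "?m dvd n"
  proof (rule ccontr)
    assume "\<not> ?m dvd n"
    then have r: "1 \<le> n mod ?m" using m by (simp add: mod_greater_zero_iff_not_dvd Suc_le_eq)
    have "g [^] n = (g [^] ?m) [^] (n div ?m) \<otimes> g [^] (n mod ?m)"
      using assms(2) by (simp add: nat_pow_pow nat_pow_mult)
    then have "g [^] (n mod ?m) = inv ((g [^] ?m) [^] (n div ?m)) \<otimes> g [^] n"
      using assms(2) by (simp add: inv_solve_left)
    then have "g [^] (n mod ?m) \<in> A" using A n by auto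
    then have "?m \<le> n mod ?m" using r unfolding relative_order_def by (intro Least_le) simp
    then show False using m by (metis mod_less_divisor not_less zero_less_one le_less_trans less_le_trans Suc_le_eq One_nat_def)
  qed
qed

section \<open>The spectrum\<close>

lemma letter_nonbacktracking:
  assumes "reduced (w @ w)" "w \<noteq> []"
  shows "letter w (Suc i) \<noteq> flip (letter w i)"
proof -
  have *: "(w @ w) ! j = letter w j" if "j < 2 * length w" for j
    using that by (cases "j < length w") (auto simp: letter_def nth_append mod_if)
  define m where "m = i mod length w"
  have m: "m < length w" using assms(2) by (simp add: m_def)
  have "(w @ w) ! Suc m \<noteq> flip ((w @ w) ! m)"
    using assms(1) m unfolding successively_conv_nth by auto
  moreover have "(w @ w) ! m = letter w m" "(w @ w) ! Suc m = letter w (Suc m)"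
    using m by (intro *; linarith)+
  moreover have "letter w m = letter w i" "letter w (Suc m) = letter w (Suc i)"
    by (simp_all add: letter_def m_def mod_Suc_eq)
  ultimately show ?thesis by simp
qed

context free_subgroup
begin

abbreviation coset_loop :: "'a set \<Rightarrow> ('a \<times> bool) list \<Rightarrow> nat \<Rightarrow> bool" where
  "coset_loop \<equiv> coset_graph.loop coset_act (rcosets A) X"

lemma relative_order_eqI:
  assumes "0 < n" "\<And>k :: nat. g [^] k \<in> A \<longleftrightarrow> n dvd k"
  shows "relative_order F A g = n"
  unfolding relative_order_def using assms by (intro Least_equality) (auto dest: dvd_imp_le)

lemma spectrumI: "g \<in> carrier F \<Longrightarrow> 1 \<le> n \<Longrightarrow> g [^] (n :: nat) \<in> A \<Longrightarrow> relative_order F A g \<in> spectrum F A"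
  unfolding spectrum_def by blast

lemma spectrumE:
  assumes "n \<in> spectrum F A"
  obtains g where "g \<in> carrier F" "1 \<le> n" "\<And>k :: nat. g [^] k \<in> A \<longleftrightarrow> n dvd k"
proof -
  obtain g k where g: "g \<in> carrier F" "1 \<le> (k :: nat)" "g [^] k \<in> A" "n = relative_order F A g"
    using assms unfolding spectrum_def by blast
  have n: "1 \<le> n" "g [^] n \<in> A" using ex_power_dvd[OF subgroup_A g(1-3)] g(4) by auto
  interpret A: subgroup A F by (rule subgroup_A)
  have pow: "(g [^] n) [^] (j :: nat) \<in> A" for j by (induction j) (use n in auto)
  have "g [^] j \<in> A \<longleftrightarrow> n dvd j" for j :: nat
  proof
    assume "g [^] j \<in> A"
    then show "n dvd j"
      using ex_power_dvd(1)[OF subgroup_A g(1), of j] g(4) by (cases "j = 0") auto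
  next
    assume "n dvd j"
    then show "g [^] j \<in> A" using pow g(1) by (auto simp: nat_pow_pow)
  qed
  then show ?thesis using that g(1) n(1) by blast
qed

text \<open>If \<open>n = d * e\<close> is the relative order of \<open>g\<close>, then
  \<open>g [^] e\<close> has relative order \<open>d\<close>.\<close>

lemma spectrum_dvd:
  assumes "n \<in> spectrum F A" "d dvd n"
  shows "d \<in> spectrum F A"
proof -
  obtain g where g: "g \<in> carrier F" "1 \<le> n" "\<And>k :: nat. g [^] k \<in> A \<longleftrightarrow> n dvd k"
    using spectrumE[OF assms(1)] by blast
  obtain e where e: "n = d * e" using assms(2) by blast
  have de: "0 < d" "0 < e" using g(2) e by (auto intro: gr0I)
  let ?g = "g [^] e"
  have dvd: "?g [^] k \<in> A \<longleftrightarrow> d dvd k" for k :: nat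
    using g(1) g(3)[of "e * k"] de by (simp add: nat_pow_pow e mult.commute[of d e])
  then have "relative_order F A ?g = d" using de by (intro relative_order_eqI)
  then show ?thesis using spectrumI[of ?g d] dvd[of d] g(1) de by simp
qed

context
  fixes Y :: "'a set" and \<Phi> :: "('a set \<times> 'a) set \<Rightarrow> 'a set"
  assumes graph: "coset_graph coset_act (rcosets A) X A Y \<Phi>"
begin

text \<open>The element is the conjugate of \<open>w\<close> by a path from \<open>A\<close> to
  \<open>U\<close>: its powers lie in \<open>A\<close> exactly when the repetitions of
  \<open>w\<close> close up at \<open>U\<close>.\<close>

lemma loop_in_spectrum:
  assumes "coset_loop U w n"
  shows "n \<in> spectrum F A"
proof -
  interpret C: coset_graph coset_act "rcosets A" X A Y \<Phi> by (rule graph)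
  have U: "U \<in> rcosets A" and w: "fst ` set w \<subseteq> X" and n: "0 < n"
    and period: "\<And>k. path U (concat (replicate k w)) = U \<longleftrightarrow> n dvd k"
    using assms unfolding C.loop_def vert_mult_length by blast+
  obtain h where h: "fst ` set h \<subseteq> X" "path A h = U" using connected_A[OF U] by blast
  let ?g = "word_value F (h @ w @ inv_word h)"
  have g: "?g [^] k \<in> A \<longleftrightarrow> n dvd k" for k :: nat
    using power_in_A_iff[OF h(1) w, of k] period by (simp only: h(2))
  have "fst ` set (h @ w @ inv_word h) \<subseteq> X" using h w by (simp add: image_Un)
  then have "?g \<in> carrier F" by (intro word_value_closed word_carrier)
  moreover have "relative_order F A ?g = n" using n g by (rule relative_order_eqI)
  ultimately show ?thesis using spectrumI[of ?g n] n g[of n] by simp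
qed

text \<open>Up to conjugation the element is a cyclically reduced word \<open>c\<close>, a power of
  a primitive word \<open>z\<close>, and \<open>m\<close> is the period of \<open>z\<close> at the
  coset reached. \<open>c\<close> is not empty because \<open>n\<close> is not 1.\<close>

lemma spectrum_dvd_loop:
  assumes "n \<in> spectrum F A" "2 \<le> n"
  shows "\<exists>U w m. n dvd m \<and> coset_loop U w m"
proof -
  interpret C: coset_graph coset_act "rcosets A" X A Y \<Phi> by (rule graph)
  obtain g where g: "g \<in> carrier F" "\<And>k :: nat. g [^] k \<in> A \<longleftrightarrow> n dvd k"
    using spectrumE[OF assms(1)] by blast
  obtain u where u: "fst ` set u \<subseteq> X" "reduced u" "word_value F u = g"
    using word_exists[OF g(1)] by blast
  obtain h c where hc: "u = h @ c @ inv_word h" "reduced (c @ c)"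
    using cyclically_reduced_conjugate[OF u(2)] by blast
  have X: "fst ` set h \<subseteq> X" "fst ` set c \<subseteq> X" using u(1) hc(1) by (auto simp: image_Un)
  let ?U = "path A h"
  have c: "path ?U (concat (replicate k c)) = ?U \<longleftrightarrow> n dvd k" for k
    using power_in_A_iff[OF X, of k] g(2)[of k] unfolding hc(1)[symmetric] u(3) by blast
  have "c \<noteq> []"
  proof
    assume "c = []"
    then have "n dvd 1" using c[of 1] by simp
    then show False using assms(2) by simp
  qed
  from rot_primitive_root[OF this] obtain z k where
    z: "rot_primitive z" "1 \<le> k" "c = concat (replicate k z)" by blast
  have zX: "fst ` set z \<subseteq> X" using X(2) z(2,3) by (cases k) (auto simp: image_Un)
  have z_ne: "z \<noteq> []" using z(1) by (simp add: rot_primitive_def)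
  have "reduced (z @ z)"
  proof -
    obtain j where "k = Suc j" using z(2) by (cases k) auto
    then have "replicate (k + k) z = z # z # replicate (j + j) z" by simp
    then have "c @ c = (z @ z) @ concat (replicate (j + j) z)"
      unfolding z(3) concat_append[symmetric] replicate_add[symmetric] by simp
    then show ?thesis using hc(2) by (metis successively_append_iff)
  qed
  have power: "concat (replicate j c) = concat (replicate (k * j) z)" for j
  proof (induction j)
    case (Suc j)
    have "concat (replicate (Suc j) c) = concat (replicate k z) @ concat (replicate j c)"
      unfolding z(3) by simp
    also have "\<dots> = concat (replicate (k + k * j) z)" unfolding Suc replicate_add by simp
    finally show ?case by simp
  qed simp
  define R where "R j \<longleftrightarrow> path ?U (concat (replicate j z)) = ?U" for j
  have R_add: "R (i + j) \<longleftrightarrow> R j" if "R i" for i j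
    using that unfolding R_def replicate_add by simp
  have R_k: "R (k * j) \<longleftrightarrow> n dvd j" for j unfolding R_def power[symmetric] by (rule c)
  define m where "m = (LEAST j. 0 < j \<and> R j)"
  have "0 < k * n \<and> R (k * n)" using R_k[of n] z(2) assms(2) by simp
  then have m: "0 < m" "R m" unfolding m_def by (metis (mono_tags, lifting) LeastI)+
  have R_mult: "R (q * m + j) \<longleftrightarrow> R j" for q j
    by (induction q) (simp_all add: R_add[OF m(2)] add.assoc)
  have R_iff: "R j \<longleftrightarrow> m dvd j" for j
  proof -
    have "R j \<longleftrightarrow> R (j mod m)" using R_mult[of "j div m" "j mod m"] by simp
    also have "\<dots> \<longleftrightarrow> j mod m = 0"
    proof
      assume "R (j mod m)"
      then have "\<not> 0 < j mod m" using m(1) not_less_Least[of "j mod m" "\<lambda>j. 0 < j \<and> R j"]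
        unfolding m_def[symmetric] by auto
      then show "j mod m = 0" by simp
    qed (simp add: R_def)
    finally show ?thesis by (simp add: dvd_eq_mod_eq_0)
  qed
  \<comment> \<open>Repeating \<open>z\<close> \<open>k * m\<close> times closes up, and this is
    \<open>c\<close> repeated \<open>m\<close> times.\<close>
  have "n dvd m" using R_k[of m] R_iff[of "k * m"] by simp
  moreover have "coset_loop ?U z m"
    unfolding C.loop_def vert_mult_length
    using zX z(1) m(1) letter_nonbacktracking[OF \<open>reduced (z @ z)\<close> z_ne] R_iff
    by (simp add: R_def)
  ultimately show ?thesis by blast
qed

end

end

theorem corollary6p5:
  fixes F :: "('a, 'b) monoid_scheme" and A :: "'a set"
  assumes "free_group F"
    and "finitely_generated_subgroup A F"
    and "A \<noteq> {\<one>\<^bsub>F\<^esub>}"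
  shows "\<exists>N :: nat set. N \<subseteq> {1..} \<and> finite N \<and> card N \<le> 13 * free_rank (F\<lparr>carrier := A\<rparr>) \<and>
           spectrum F A = (\<Union>n\<in>N. \<Union>d\<in>{d. 1 \<le> d \<and> d dvd n}. {d})"
proof -
  interpret F: group F using assms(1) by (simp add: free_group_def)
  obtain X where X: "free_basis F X" using assms(1) by (auto simp: free_group_def)
  obtain S where A: "subgroup A F" and S: "finite S" "S \<subseteq> carrier F" "A = generate F S"
    using assms(2) unfolding finitely_generated_subgroup_def by blast
  interpret free_subgroup F X A by (intro free_subgroup.intro free_subgroup_axioms.intro F.group_axioms X A)
  let ?H = "F\<lparr>carrier := A\<rparr>"
  interpret H: group ?H by (rule F.subgroup_imp_group[OF A])
  define Y where "Y = (SOME Y. free_basis ?H Y)"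
  \<comment> \<open>\<open>Y\<close> is the basis chosen in \<open>free_rank\<close>; the
    Nielsen-Schreier theorem provides one to choose.\<close>
  have Y: "free_basis ?H Y" unfolding Y_def by (rule someI, rule free_basis_schreier_basis)
  have SA: "S \<subseteq> A" using S(3) by (auto intro: generate.incl)
  have "finite Y"
    by (rule H.finite_free_basis[OF Y S(1)]) (use SA S(3) F.generate_consistent[OF SA A] in simp_all)
  have rank: "free_rank ?H = card Y" by (simp add: free_rank_def Y_def)
  \<comment> \<open>Positive rank ensures that elements above \<open>10 * card Y\<close> are at
    least 2, as \<open>spectrum_dvd_loop\<close> requires.\<close>
  have "card Y \<noteq> 0"
  proof
    assume "card Y = 0"
    then have "Y = {}" using \<open>finite Y\<close> by simp
    then have "a = \<one>\<^bsub>F\<^esub>" if "a \<in> A" for a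
      using H.free_basis_word[OF Y, of a] that by auto
    then have "A = {\<one>\<^bsub>F\<^esub>}" using subgroup.one_closed[OF A] by blast
    then show False using assms(3) by contradiction
  qed
  obtain \<Phi> where graph: "coset_graph coset_act (rcosets\<^bsub>F\<^esub> A) X A Y \<Phi>"
    using coset_graph_exists[OF Y \<open>finite Y\<close>] by blast
  interpret C: coset_graph coset_act "rcosets\<^bsub>F\<^esub> A" X A Y \<Phi> by (rule graph)
  let ?r = "card Y"
  define L where "L = {n. 10 * ?r < n \<and> (\<exists>U w. C.loop U w n)}"
  \<comment> \<open>At most \<open>10 * card Y\<close> small elements and \<open>card Y\<close> long
    periods, hence \<open>11 * card Y\<close> in all, within the claimed bound.\<close>
  define N where "N = {n \<in> spectrum F A. n \<le> 10 * ?r} \<union> L"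
  have N_spec: "N \<subseteq> spectrum F A" using loop_in_spectrum[OF graph] by (auto simp: N_def L_def)
  have pos: "1 \<le> n" if "n \<in> spectrum F A" for n using spectrumE[OF that] by blast
  have small: "{n \<in> spectrum F A. n \<le> 10 * ?r} \<subseteq> {1..10 * ?r}" using pos by auto
  have L: "finite L" "card L \<le> ?r" using C.card_long_loop_periods by (simp_all add: L_def)
  have max: "\<exists>m\<in>N. n dvd m" if n: "n \<in> spectrum F A" for n
  proof (cases "n \<le> 10 * ?r")
    case True
    then have "n \<in> N" using n by (simp add: N_def)
    then show ?thesis using dvd_refl by blast
  next
    case False
    then have "2 \<le> n" using \<open>card Y \<noteq> 0\<close> by linarith
    then obtain U w m where m: "n dvd m" "C.loop U w m"
      using spectrum_dvd_loop[OF graph n] by blast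
    then have "n \<le> m" using C.n_pos by (intro dvd_imp_le)
    then have "m \<in> L" using False m by (auto simp: L_def)
    then show ?thesis using m(1) by (auto simp: N_def)
  qed
  have "card {n \<in> spectrum F A. n \<le> 10 * ?r} \<le> 10 * ?r"
    using card_mono[OF _ small] by simp
  then have "card N \<le> 13 * free_rank ?H"
    using card_Un_le[of "{n \<in> spectrum F A. n \<le> 10 * ?r}" L] L(2) by (simp add: N_def rank)
  moreover have "finite N" using finite_subset[OF small] L(1) by (simp add: N_def)
  moreover have "spectrum F A = (\<Union>n\<in>N. \<Union>d\<in>{d. 1 \<le> d \<and> d dvd n}. {d})"
  proof (intro equalityI subsetI)
    fix d assume "d \<in> spectrum F A"
    with max[OF this] pos[OF this] show "d \<in> (\<Union>n\<in>N. \<Union>d\<in>{d. 1 \<le> d \<and> d dvd n}. {d})" by simp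
  next
    fix d assume "d \<in> (\<Union>n\<in>N. \<Union>d\<in>{d. 1 \<le> d \<and> d dvd n}. {d})"
    then obtain n where "n \<in> N" "d dvd n" by blast
    then show "d \<in> spectrum F A" using N_spec spectrum_dvd by blast
  qed
  moreover have "N \<subseteq> {1..}" using N_spec pos by auto
  ultimately show ?thesis by (intro exI[of _ N] conjI)
qed

end
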